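(* For every plurihomogeneous polynomial $f\in C$ of degree $(\nu_1,\dots,\nu_s)\in\mathbb{N}^s$, written $f=f(\varepsilon_1,\dots,\varepsilon_r,\underline{X}_1,\dots,\underline{X}_s)\in A'[\varepsilon_1,\dots,\varepsilon_r,\underline{X}_1,\dots,\underline{X}_s]=C$, the following assertions are equivalent: 1. $f\in\mathcal{T}$. 2. $\dfrac{f}{X_{1,n_1+1}^{\nu_1}\cdots X_{s,n_s+1}^{\nu_s}}=0$ in $(B_{\sigma_q})_{(0,\dots,0)}$, the part of degree $(0,\dots,0)$ of $B_{\sigma_q}$. 3. $f(-\widetilde{h}_1,\dots,-\widetilde{h}_r,\widetilde{\underline{X}}_1,\dots,\widetilde{\underline{X}}_s)=0$ in $C$.
   Context: Let $K$ be a commutative integral domain, $s\ge 1$, and $n_s\ge\dots\ge n_1\ge 1$ integers. For $1\le j\le s$ let $\underline{X}_j=(X_{j,1},\dots,X_{j,n_j+1})$ be a packet of indeterminates; for $\underline{\alpha}_j\in\mathbb{N}^{n_j+1}$ let $|\underline{\alpha}_j|$ be the sum of its entries and $\underline{X}_j^{\underline{\alpha}_j}$ the corresponding monomial. Let $r\in\mathbb{N}$ and $d_{i,j}\ge 1$ ($1\le i\le r$, $1\le j\le s$) be integers. Let $A=K[U_{i,\underline{\alpha}_1,\dots,\underline{\alpha}_s}]$ be the polynomial ring in indeterminates indexed by $1\le i\le r$ and $\underline{\alpha}_j\in\mathbb{N}^{n_j+1}$ with $|\underline{\alpha}_j|=d_{i,j}$ for all $j$. Let $C=A[\underline{X}_1,\dots,\underline{X}_s]$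 and $f_i=\sum U_{i,\underline{\alpha}_1,\dots,\underline{\alpha}_s}\underline{X}_1^{\underline{\alpha}_1}\cdots\underline{X}_s^{\underline{\alpha}_s}\in C$ (sum over all $(\underline{\alpha}_j)_j$ with $|\underline{\alpha}_j|=d_{i,j}$). $C$ is $\mathbb{N}^s$-graded with elements of $A$ in degree $0$ and $\deg X_{j,l}$ equal to the $j$-th standard basis vector; "plurihomogeneous" means homogeneous for this grading. Put $B=C/(f_1,\dots,f_r)$, with the induced grading; localizations of $B$ at monomials in the $X_{j,l}$ are $\mathbb{Z}^s$-graded. For $1\le i_j\le n_j+1$ put $\sigma_{i_1\dots i_s}=X_{1,i_1}\cdots X_{s,i_s}$, and $\sigma_q=X_{1,n_1+1}\cdots X_{s,n_s+1}$. Let $p:C\to B$ be the canonical surjection and $\pi:B\to\prod_{i_1,\dots,i_s}B_{\sigma_{i_1\dots i_s}}$, $b\mapsto(b/1,\dots,b/1)$. The ideal of forms of inertia is $\mathcal{T}=p^{-1}(\ker\pi)$. Let $\tau_i=X_{1,n_1+1}^{d_{i,1}}\cdots X_{s,n_s+1}^{d_{i,s}}$, let $\varepsilon_i$ be the coefficient (one of the indeterminates $U$) of $\tau_i$ in $f_i$, and $h_i=f_i-\varepsilon_i\tau_i$. Let $A'$ be the polynomial ring over $K$ in all the indeterminates $U_{i,\underline{\alpha}_1,\dots,\underline{\alpha}_s}$ other than $\varepsilon_1,\dots,\varepsilon_r$, so $A=A'[\varepsilon_1,\dots,\varepsilon_r]$. Put $\widetilde{\underline{X}}_j=(X_{j,1},\dots,X_{j,n_j},1)$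 and, for $g\in C$, $\widetilde{g}=g(\widetilde{\underline{X}}_1,\dots,\widetilde{\underline{X}}_s)$ (substitute $1$ for each $X_{j,n_j+1}$). *)

theory Defs
  imports "HOL-Algebra.QuotRing" "HOL-Library.Poly_Mapping" "HOL-Library.FuncSet"
begin

section \<open>Localization and products of rings\<close>

text \<open>The fraction \<open>a/s\<close> is the class of \<open>(a, s)\<close> for the usual relation on \<open>carrier R \<times> S\<close>,
  in which \<open>(a, s)\<close> and \<open>(b, t)\<close> are identified iff \<open>u t a = u s b\<close> for some \<open>u \<in> S\<close>.
  The set \<open>S\<close> is meant to be a submonoid of the multiplicative monoid of \<open>R\<close>; zero divisors
  in \<open>S\<close> are allowed.\<close>

definition fraction :: "('a, 'm) ring_scheme \<Rightarrow> 'a set \<Rightarrow> 'a \<Rightarrow> 'a \<Rightarrow> ('a \<times> 'a) set" where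
  "fraction R S a s = {(b, t). b \<in> carrier R \<and> t \<in> S \<and>
     (\<exists>u\<in>S. u \<otimes>\<^bsub>R\<^esub> (t \<otimes>\<^bsub>R\<^esub> a) = u \<otimes>\<^bsub>R\<^esub> (s \<otimes>\<^bsub>R\<^esub> b))}"

text \<open>The unions below run over all representatives, as for cosets in
  \<^theory>\<open>HOL-Algebra.QuotRing\<close>; all members of such a union are the same class
  (lemmas \<open>localization_mult\<close> and \<open>localization_add\<close>).\<close>

definition localization :: "('a, 'm) ring_scheme \<Rightarrow> 'a set \<Rightarrow> ('a \<times> 'a) set ring" where
  "localization R S =
     \<lparr>carrier = {fraction R S a s | a s. a \<in> carrier R \<and> s \<in> S},
      mult = (\<lambda>x y. \<Union>(a, s)\<in>x. \<Union>(b, t)\<in>y. fraction R S (a \<otimes>\<^bsub>R\<^esub> b) (s \<otimes>\<^bsub>R\<^esub> t)),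
      one = fraction R S \<one>\<^bsub>R\<^esub> \<one>\<^bsub>R\<^esub>,
      zero = fraction R S \<zero>\<^bsub>R\<^esub> \<one>\<^bsub>R\<^esub>,
      add = (\<lambda>x y. \<Union>(a, s)\<in>x. \<Union>(b, t)\<in>y.
               fraction R S (t \<otimes>\<^bsub>R\<^esub> a \<oplus>\<^bsub>R\<^esub> s \<otimes>\<^bsub>R\<^esub> b) (s \<otimes>\<^bsub>R\<^esub> t))\<rparr>"

definition powers :: "('a, 'm) ring_scheme \<Rightarrow> 'a \<Rightarrow> 'a set" where
  "powers R x = {x [^]\<^bsub>R\<^esub> k | k::nat. True}"

definition product_ring :: "'i set \<Rightarrow> ('i \<Rightarrow> ('a, 'm) ring_scheme) \<Rightarrow> ('i \<Rightarrow> 'a) ring" where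
  "product_ring I R =
     \<lparr>carrier = (\<Pi>\<^sub>E i\<in>I. carrier (R i)),
      mult = (\<lambda>x y. \<lambda>i\<in>I. x i \<otimes>\<^bsub>R i\<^esub> y i),
      one = (\<lambda>i\<in>I. \<one>\<^bsub>R i\<^esub>),
      zero = (\<lambda>i\<in>I. \<zero>\<^bsub>R i\<^esub>),
      add = (\<lambda>x y. \<lambda>i\<in>I. x i \<oplus>\<^bsub>R i\<^esub> y i)\<rparr>"

context cring begin

lemma fraction_eq_iff:
  assumes S: "submonoid S R" and a: "a \<in> carrier R" "s \<in> S" and b: "b \<in> carrier R" "t \<in> S"
  shows "fraction R S a s = fraction R S b t \<longleftrightarrow>
         (\<exists>u\<in>S. u \<otimes> (t \<otimes> a) = u \<otimes> (s \<otimes> b))"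
proof
  interpret S: submonoid S R by fact
  have self: "(b, t) \<in> fraction R S b t"
    using b S.one_closed by (auto simp: fraction_def)
  show "\<exists>u\<in>S. u \<otimes> (t \<otimes> a) = u \<otimes> (s \<otimes> b)" if "fraction R S a s = fraction R S b t"
  proof -
    have "(b, t) \<in> fraction R S a s" using self that by simp
    then show ?thesis by (auto simp: fraction_def)
  qed
  have trans: "fraction R S a s \<subseteq> fraction R S b t"
    if ab: "a \<in> carrier R" "s \<in> S" "b \<in> carrier R" "t \<in> S"
      and u: "u \<in> S" "u \<otimes> (t \<otimes> a) = u \<otimes> (s \<otimes> b)" for a s b t u
  proof (clarsimp simp: fraction_def)
    fix c v w assume c: "c \<in> carrier R" "v \<in> S" "w \<in> S" "w \<otimes> (v \<otimes> a) = w \<otimes> (s \<otimes> c)"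
    have [simp]: "a \<in> carrier R" "s \<in> carrier R" "b \<in> carrier R" "t \<in> carrier R" "u \<in> carrier R"
      "c \<in> carrier R" "v \<in> carrier R" "w \<in> carrier R" using ab u c by auto
    have "(s \<otimes> u \<otimes> w) \<otimes> (v \<otimes> b) = (w \<otimes> v) \<otimes> (u \<otimes> (s \<otimes> b))" by (simp add: m_ac)
    also have "\<dots> = (w \<otimes> v) \<otimes> (u \<otimes> (t \<otimes> a))" by (simp only: u)
    also have "\<dots> = (u \<otimes> t) \<otimes> (w \<otimes> (v \<otimes> a))" by (simp add: m_ac)
    also have "\<dots> = (s \<otimes> u \<otimes> w) \<otimes> (t \<otimes> c)" by (subst c) (simp add: m_ac)
    finally show "\<exists>u\<in>S. u \<otimes> (v \<otimes> b) = u \<otimes> (t \<otimes> c)"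
      using ab u c by (intro bexI[of _ "s \<otimes> u \<otimes> w"]) auto
  qed
  assume "\<exists>u\<in>S. u \<otimes> (t \<otimes> a) = u \<otimes> (s \<otimes> b)"
  then obtain u where u: "u \<in> S" "u \<otimes> (t \<otimes> a) = u \<otimes> (s \<otimes> b)" by blast
  then show "fraction R S a s = fraction R S b t"
    using trans[OF a b u] trans[OF b a u(1)] by simp
qed

lemma mem_fraction_iff:
  assumes S: "submonoid S R" and a: "a \<in> carrier R" "s \<in> S"
  shows "(b, t) \<in> fraction R S a s \<longleftrightarrow>
         b \<in> carrier R \<and> t \<in> S \<and> fraction R S b t = fraction R S a s"
proof -
  have "fraction R S a s = fraction R S b t \<longleftrightarrow> (\<exists>u\<in>S. u \<otimes> (t \<otimes> a) = u \<otimes> (s \<otimes> b))"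
    if "b \<in> carrier R" "t \<in> S" using fraction_eq_iff[OF S a that] .
  then show ?thesis by (auto simp: fraction_def)
qed

lemma localization_mult:
  assumes S: "submonoid S R" and a: "a \<in> carrier R" "s \<in> S" and b: "b \<in> carrier R" "t \<in> S"
  shows "fraction R S a s \<otimes>\<^bsub>localization R S\<^esub> fraction R S b t = fraction R S (a \<otimes> b) (s \<otimes> t)"
proof -
  interpret S: submonoid S R by fact
  have eq: "fraction R S (a' \<otimes> b') (s' \<otimes> t') = fraction R S (a \<otimes> b) (s \<otimes> t)"
    if a': "(a', s') \<in> fraction R S a s" and b': "(b', t') \<in> fraction R S b t" for a' s' b' t'
  proof -
    obtain u where u: "u \<in> S" "u \<otimes> (s' \<otimes> a) = u \<otimes> (s \<otimes> a')" "a' \<in> carrier R" "s' \<in> S"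
      using a' by (auto simp: fraction_def)
    obtain v where v: "v \<in> S" "v \<otimes> (t' \<otimes> b) = v \<otimes> (t \<otimes> b')" "b' \<in> carrier R" "t' \<in> S"
      using b' by (auto simp: fraction_def)
    have [simp]: "a \<in> carrier R" "s \<in> carrier R" "b \<in> carrier R" "t \<in> carrier R" "u \<in> carrier R"
      "a' \<in> carrier R" "s' \<in> carrier R" "b' \<in> carrier R" "t' \<in> carrier R" "v \<in> carrier R"
      using a b u v S.mem_carrier by auto
    have "(u \<otimes> v) \<otimes> ((s \<otimes> t) \<otimes> (a' \<otimes> b')) = (u \<otimes> (s \<otimes> a')) \<otimes> (v \<otimes> (t \<otimes> b'))"
      by (simp add: m_ac)
    also have "\<dots> = (u \<otimes> (s' \<otimes> a)) \<otimes> (v \<otimes> (t' \<otimes> b))" by (simp only: u v)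
    also have "\<dots> = (u \<otimes> v) \<otimes> ((s' \<otimes> t') \<otimes> (a \<otimes> b))" by (simp add: m_ac)
    finally show ?thesis
      using a b u v by (subst fraction_eq_iff[OF S]) (auto intro!: bexI[of _ "u \<otimes> v"])
  qed
  have mem: "(a, s) \<in> fraction R S a s" "(b, t) \<in> fraction R S b t"
    using a b by (auto simp: mem_fraction_iff[OF S])
  have "(\<Union>(a, s)\<in>fraction R S a s. \<Union>(b, t)\<in>fraction R S b t. fraction R S (a \<otimes> b) (s \<otimes> t))
      = fraction R S (a \<otimes> b) (s \<otimes> t)" (is "?L = ?R")
  proof
    show "?L \<subseteq> ?R" using eq by blast
    show "?R \<subseteq> ?L" using mem by blast
  qed
  then show ?thesis by (simp add: localization_def)
qed

lemma localization_add:
  assumes S: "submonoid S R" and a: "a \<in> carrier R" "s \<in> S" and b: "b \<in> carrier R" "t \<in> S"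
  shows "fraction R S a s \<oplus>\<^bsub>localization R S\<^esub> fraction R S b t =
         fraction R S (t \<otimes> a \<oplus> s \<otimes> b) (s \<otimes> t)"
proof -
  interpret S: submonoid S R by fact
  have eq: "fraction R S (t' \<otimes> a' \<oplus> s' \<otimes> b') (s' \<otimes> t') = fraction R S (t \<otimes> a \<oplus> s \<otimes> b) (s \<otimes> t)"
    if a': "(a', s') \<in> fraction R S a s" and b': "(b', t') \<in> fraction R S b t" for a' s' b' t'
  proof -
    obtain u where u: "u \<in> S" "u \<otimes> (s' \<otimes> a) = u \<otimes> (s \<otimes> a')" "a' \<in> carrier R" "s' \<in> S"
      using a' by (auto simp: fraction_def)
    obtain v where v: "v \<in> S" "v \<otimes> (t' \<otimes> b) = v \<otimes> (t \<otimes> b')" "b' \<in> carrier R" "t' \<in> S"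
      using b' by (auto simp: fraction_def)
    have [simp]: "a \<in> carrier R" "s \<in> carrier R" "b \<in> carrier R" "t \<in> carrier R" "u \<in> carrier R"
      "a' \<in> carrier R" "s' \<in> carrier R" "b' \<in> carrier R" "t' \<in> carrier R" "v \<in> carrier R"
      using a b u v S.mem_carrier by auto
    have "(u \<otimes> v) \<otimes> ((s \<otimes> t) \<otimes> (t' \<otimes> a' \<oplus> s' \<otimes> b')) =
        (v \<otimes> t \<otimes> t') \<otimes> (u \<otimes> (s \<otimes> a')) \<oplus> (u \<otimes> s \<otimes> s') \<otimes> (v \<otimes> (t \<otimes> b'))"
      by (simp add: m_ac r_distr)
    also have "\<dots> = (v \<otimes> t \<otimes> t') \<otimes> (u \<otimes> (s' \<otimes> a)) \<oplus> (u \<otimes> s \<otimes> s') \<otimes> (v \<otimes> (t' \<otimes> b))"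
      by (simp only: u v)
    also have "\<dots> = (u \<otimes> v) \<otimes> ((s' \<otimes> t') \<otimes> (t \<otimes> a \<oplus> s \<otimes> b))"
      by (simp add: m_ac r_distr)
    finally show ?thesis
      using a b u v by (subst fraction_eq_iff[OF S]) (auto intro!: bexI[of _ "u \<otimes> v"])
  qed
  have mem: "(a, s) \<in> fraction R S a s" "(b, t) \<in> fraction R S b t"
    using a b by (auto simp: mem_fraction_iff[OF S])
  have "(\<Union>(a, s)\<in>fraction R S a s. \<Union>(b, t)\<in>fraction R S b t.
          fraction R S (t \<otimes> a \<oplus> s \<otimes> b) (s \<otimes> t))
      = fraction R S (t \<otimes> a \<oplus> s \<otimes> b) (s \<otimes> t)" (is "?L = ?R")
  proof
    show "?L \<subseteq> ?R" using eq by blast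
    show "?R \<subseteq> ?L" using mem by blast
  qed
  then show ?thesis by (simp add: localization_def)
qed

lemma fraction_eqI:
  assumes S: "submonoid S R" and a: "a \<in> carrier R" "s \<in> S" and b: "b \<in> carrier R" "t \<in> S"
    and eq: "t \<otimes> a = s \<otimes> b"
  shows "fraction R S a s = fraction R S b t"
  using submonoid.one_closed[OF S] by (auto simp: fraction_eq_iff[OF S a b] eq)

lemma localization_cring:
  assumes S: "submonoid S R"
  shows "cring (localization R S)"
proof -
  interpret S: submonoid S R by fact
  let ?L = "localization R S"
  note mult = localization_mult[OF S] and add = localization_add[OF S]
  note [simp] = S.mem_carrier
  have carrier: "x \<in> carrier ?L \<longleftrightarrow> (\<exists>a s. x = fraction R S a s \<and> a \<in> carrier R \<and> s \<in> S)" for x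
    by (auto simp: localization_def)
  have one: "\<one>\<^bsub>?L\<^esub> = fraction R S \<one> \<one>" and zero: "\<zero>\<^bsub>?L\<^esub> = fraction R S \<zero> \<one>"
    by (simp_all add: localization_def)
  note eqI = fraction_eqI[OF S]
  show ?thesis
  proof (intro cringI abelian_groupI comm_monoidI)
    fix x y z assume "x \<in> carrier ?L" "y \<in> carrier ?L" "z \<in> carrier ?L"
    then obtain a s b t c v where x: "x = fraction R S a s" "a \<in> carrier R" "s \<in> S"
      and y: "y = fraction R S b t" "b \<in> carrier R" "t \<in> S"
      and z: "z = fraction R S c v" "c \<in> carrier R" "v \<in> S"
      by (auto simp: carrier)
    have [simp]: "a \<in> carrier R" "s \<in> carrier R" "b \<in> carrier R" "t \<in> carrier R"
      "c \<in> carrier R" "v \<in> carrier R" using x y z by auto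
    show "x \<oplus>\<^bsub>?L\<^esub> y \<oplus>\<^bsub>?L\<^esub> z = x \<oplus>\<^bsub>?L\<^esub> (y \<oplus>\<^bsub>?L\<^esub> z)"
      unfolding x y z using x y z by (simp add: add) (rule eqI; simp add: m_ac a_ac r_distr l_distr)
    show "x \<otimes>\<^bsub>?L\<^esub> y \<otimes>\<^bsub>?L\<^esub> z = x \<otimes>\<^bsub>?L\<^esub> (y \<otimes>\<^bsub>?L\<^esub> z)"
      unfolding x y z using x y z by (simp add: mult) (rule eqI; simp add: m_ac a_ac r_distr l_distr)
    show "(x \<oplus>\<^bsub>?L\<^esub> y) \<otimes>\<^bsub>?L\<^esub> z = x \<otimes>\<^bsub>?L\<^esub> z \<oplus>\<^bsub>?L\<^esub> y \<otimes>\<^bsub>?L\<^esub> z"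
      unfolding x y z using x y z by (simp add: mult add) (rule eqI; simp add: m_ac a_ac r_distr l_distr)
  next
    fix x y assume "x \<in> carrier ?L" "y \<in> carrier ?L"
    then obtain a s b t where x: "x = fraction R S a s" "a \<in> carrier R" "s \<in> S"
      and y: "y = fraction R S b t" "b \<in> carrier R" "t \<in> S"
      by (auto simp: carrier)
    have [simp]: "a \<in> carrier R" "s \<in> carrier R" "b \<in> carrier R" "t \<in> carrier R"
      using x y by auto
    have st: "s \<otimes> t \<in> S" using x y by simp
    show "x \<oplus>\<^bsub>?L\<^esub> y \<in> carrier ?L"
      unfolding carrier x(1) y(1) add[OF x(2,3) y(2,3)]
      by (intro exI conjI, rule refl) (use st in simp_all)
    show "x \<otimes>\<^bsub>?L\<^esub> y \<in> carrier ?L"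
      unfolding carrier x(1) y(1) mult[OF x(2,3) y(2,3)]
      by (intro exI conjI, rule refl) (use st in simp_all)
    show "x \<oplus>\<^bsub>?L\<^esub> y = y \<oplus>\<^bsub>?L\<^esub> x"
      unfolding x y using x y by (simp add: add) (rule eqI; simp add: m_ac a_ac r_distr l_distr)
    show "x \<otimes>\<^bsub>?L\<^esub> y = y \<otimes>\<^bsub>?L\<^esub> x"
      unfolding x y using x y by (simp add: mult) (rule eqI; simp add: m_ac a_ac r_distr l_distr)
  next
    fix x assume "x \<in> carrier ?L"
    then obtain a s where x: "x = fraction R S a s" "a \<in> carrier R" "s \<in> S"
      by (auto simp: carrier)
    have [simp]: "a \<in> carrier R" "s \<in> carrier R" using x by auto
    show "\<zero>\<^bsub>?L\<^esub> \<oplus>\<^bsub>?L\<^esub> x = x"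
      unfolding x zero using x by (simp add: add)
    show "\<one>\<^bsub>?L\<^esub> \<otimes>\<^bsub>?L\<^esub> x = x"
      unfolding x one using x by (simp add: mult)
    have "fraction R S (\<ominus> a) s \<oplus>\<^bsub>?L\<^esub> x = \<zero>\<^bsub>?L\<^esub>"
      unfolding x zero using x by (simp add: add) (rule eqI; simp add: r_minus l_neg)
    moreover have "fraction R S (\<ominus> a) s \<in> carrier ?L"
      using x unfolding carrier by blast
    ultimately show "\<exists>y\<in>carrier ?L. y \<oplus>\<^bsub>?L\<^esub> x = \<zero>\<^bsub>?L\<^esub>" by blast
  next
    show "\<zero>\<^bsub>?L\<^esub> \<in> carrier ?L" "\<one>\<^bsub>?L\<^esub> \<in> carrier ?L"
      unfolding carrier one zero using S.one_closed by blast+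
  qed
qed

lemma powers_submonoid:
  assumes "x \<in> carrier R" shows "submonoid (powers R x) R"
proof
  show "powers R x \<subseteq> carrier R" using assms by (auto simp: powers_def)
  show "\<one> \<in> powers R x" unfolding powers_def by (auto intro: exI[of _ "0::nat"])
  show "a \<otimes> b \<in> powers R x" if "a \<in> powers R x" "b \<in> powers R x" for a b
    using that assms by (auto simp: powers_def nat_pow_mult)
qed

end


section \<open>Polynomial rings\<close>

text \<open>Polynomials over \<open>'k\<close> in variables from \<open>'v\<close> are the finitely supported functions
  \<^typ>\<open>('v \<Rightarrow>\<^sub>0 nat) \<Rightarrow>\<^sub>0 'k\<close> with the convolution product of \<^theory>\<open>HOL-Library.Poly_Mapping\<close>.\<close>

type_synonym ('v, 'k) mpoly = "('v \<Rightarrow>\<^sub>0 nat) \<Rightarrow>\<^sub>0 'k"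

definition Const :: "'k \<Rightarrow> ('v, 'k::comm_ring_1) mpoly" where
  "Const c = Poly_Mapping.single 0 c"

definition Var :: "'v \<Rightarrow> ('v, 'k::comm_ring_1) mpoly" where
  "Var v = Poly_Mapping.single (Poly_Mapping.single v 1) 1"

definition mpoly_ring :: "'v set \<Rightarrow> ('v, 'k::comm_ring_1) mpoly ring" where
  "mpoly_ring V =
     \<lparr>carrier = {p. \<forall>m\<in>Poly_Mapping.keys p. Poly_Mapping.keys m \<subseteq> V},
      mult = (*), one = 1, zero = 0, add = (+)\<rparr>"

definition subst :: "('v \<Rightarrow> ('w, 'k) mpoly) \<Rightarrow> ('v, 'k::comm_ring_1) mpoly \<Rightarrow> ('w, 'k) mpoly" where
  "subst \<phi> p = (\<Sum>m\<in>Poly_Mapping.keys p. Const (Poly_Mapping.lookup p m) *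
                  (\<Prod>v\<in>Poly_Mapping.keys m. \<phi> v ^ Poly_Mapping.lookup m v))"

lemma mpoly_ring_cring: "cring (mpoly_ring V :: ('v, 'k::comm_ring_1) mpoly ring)"
proof -
  have keys_minus: "Poly_Mapping.keys (- p) = Poly_Mapping.keys p" for p :: "('v, 'k) mpoly"
    by (auto simp: in_keys_iff)
  show ?thesis
  proof (intro cringI abelian_groupI comm_monoidI)
    fix x y :: "('v, 'k) mpoly"
    assume xy: "x \<in> carrier (mpoly_ring V)" "y \<in> carrier (mpoly_ring V)"
    then show "x \<oplus>\<^bsub>mpoly_ring V\<^esub> y \<in> carrier (mpoly_ring V)"
      using keys_add[of x y] by (auto simp: mpoly_ring_def)
    show "x \<otimes>\<^bsub>mpoly_ring V\<^esub> y \<in> carrier (mpoly_ring V)"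
    proof -
      have "Poly_Mapping.keys m \<subseteq> V" if m: "m \<in> Poly_Mapping.keys (x * y)" for m
      proof -
        obtain a b where "m = a + b" "a \<in> Poly_Mapping.keys x" "b \<in> Poly_Mapping.keys y"
          using subsetD[OF keys_mult m] by blast
        then show ?thesis
          using xy keys_add[of a b] by (simp add: mpoly_ring_def) blast
      qed
      then show ?thesis by (simp add: mpoly_ring_def)
    qed
  next
    fix x :: "('v, 'k) mpoly"
    assume "x \<in> carrier (mpoly_ring V)"
    then show "\<exists>y\<in>carrier (mpoly_ring V). y \<oplus>\<^bsub>mpoly_ring V\<^esub> x = \<zero>\<^bsub>mpoly_ring V\<^esub>"
      by (intro bexI[of _ "- x"]) (auto simp: mpoly_ring_def keys_minus)
  qed (auto simp: mpoly_ring_def algebra_simps)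
qed


section \<open>The generic plurihomogeneous system\<close>

text \<open>\<open>U i \<alpha>\<close> stands for the coefficient indeterminate of index \<open>i, \<alpha>\<^sub>1, \<dots>, \<alpha>\<^sub>s\<close>, with
  \<open>\<alpha> j l\<close> the \<open>l\<close>-th entry of \<open>\<alpha>\<^sub>j\<close>; \<open>X j l\<close> stands for \<open>X\<^bsub>j,l\<^esub>\<close>.\<close>

datatype indet = U nat "nat \<Rightarrow> nat \<Rightarrow> nat" | X nat nat

text \<open>Throughout, \<open>s\<close>, \<open>n j\<close>, \<open>r\<close>, \<open>d i j\<close> are the integer parameters. Packets \<open>j\<close> run through
  \<open>1..s\<close>, entries \<open>l\<close> of packet \<open>j\<close> through \<open>1..n j + 1\<close>, equations \<open>i\<close> through \<open>1..r\<close>.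
  Requiring \<open>\<alpha> j l = 0\<close> outside this range makes the function \<open>\<alpha>\<close> determined by the tuples
  \<open>\<alpha>\<^sub>1, \<dots>, \<alpha>\<^sub>s\<close>, so that the indeterminates \<open>U i \<alpha>\<close> are indexed without repetition.\<close>

definition multi_exps :: "nat \<Rightarrow> (nat \<Rightarrow> nat) \<Rightarrow> (nat \<Rightarrow> nat \<Rightarrow> nat) \<Rightarrow> nat \<Rightarrow> (nat \<Rightarrow> nat \<Rightarrow> nat) set" where
  "multi_exps s n d i =
     {\<alpha>. (\<forall>j l. \<not> (j \<in> {1..s} \<and> l \<in> {1..n j + 1}) \<longrightarrow> \<alpha> j l = 0) \<and>
         (\<forall>j\<in>{1..s}. (\<Sum>l=1..n j + 1. \<alpha> j l) = d i j)}"

definition U_indets :: "nat \<Rightarrow> (nat \<Rightarrow> nat) \<Rightarrow> nat \<Rightarrow> (nat \<Rightarrow> nat \<Rightarrow> nat) \<Rightarrow> indet set" where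
  "U_indets s n r d = {U i \<alpha> | i \<alpha>. i \<in> {1..r} \<and> \<alpha> \<in> multi_exps s n d i}"

definition X_indets :: "nat \<Rightarrow> (nat \<Rightarrow> nat) \<Rightarrow> indet set" where
  "X_indets s n = {X j l | j l. j \<in> {1..s} \<and> l \<in> {1..n j + 1}}"

text \<open>The iterated polynomial ring \<open>C = A[X]\<close> with \<open>A = K[U]\<close> is taken as \<open>K[U, X]\<close>.\<close>

definition ring_C :: "nat \<Rightarrow> (nat \<Rightarrow> nat) \<Rightarrow> nat \<Rightarrow> (nat \<Rightarrow> nat \<Rightarrow> nat) \<Rightarrow>
    (indet, 'k::comm_ring_1) mpoly ring" where
  "ring_C s n r d = mpoly_ring (U_indets s n r d \<union> X_indets s n)"

definition gen_poly :: "nat \<Rightarrow> (nat \<Rightarrow> nat) \<Rightarrow> (nat \<Rightarrow> nat \<Rightarrow> nat) \<Rightarrow> nat \<Rightarrow>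
    (indet, 'k::comm_ring_1) mpoly" where
  "gen_poly s n d i = (\<Sum>\<alpha>\<in>multi_exps s n d i.
     Var (U i \<alpha>) * (\<Prod>j=1..s. \<Prod>l=1..n j + 1. Var (X j l) ^ \<alpha> j l))"

text \<open>The \<open>\<nat>\<^sup>s\<close>-grading of \<open>C\<close>: the indeterminates \<open>U\<close> do not contribute to the degree.
  Only the values \<open>\<nu> j\<close> with \<open>j \<in> {1..s}\<close> matter.\<close>

definition C_part :: "nat \<Rightarrow> (nat \<Rightarrow> nat) \<Rightarrow> nat \<Rightarrow> (nat \<Rightarrow> nat \<Rightarrow> nat) \<Rightarrow> (nat \<Rightarrow> nat) \<Rightarrow>
    (indet, 'k::comm_ring_1) mpoly set" where
  "C_part s n r d \<nu> = {f \<in> carrier (ring_C s n r d). \<forall>m\<in>Poly_Mapping.keys f. \<forall>j\<in>{1..s}.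
     (\<Sum>l=1..n j + 1. Poly_Mapping.lookup m (X j l)) = \<nu> j}"

definition ideal_f :: "nat \<Rightarrow> (nat \<Rightarrow> nat) \<Rightarrow> nat \<Rightarrow> (nat \<Rightarrow> nat \<Rightarrow> nat) \<Rightarrow>
    (indet, 'k::comm_ring_1) mpoly set" where
  "ideal_f s n r d = genideal (ring_C s n r d) (gen_poly s n d ` {1..r})"

definition ring_B :: "nat \<Rightarrow> (nat \<Rightarrow> nat) \<Rightarrow> nat \<Rightarrow> (nat \<Rightarrow> nat \<Rightarrow> nat) \<Rightarrow>
    (indet, 'k::comm_ring_1) mpoly set ring" where
  "ring_B s n r d = ring_C s n r d Quot ideal_f s n r d"

definition proj_B :: "nat \<Rightarrow> (nat \<Rightarrow> nat) \<Rightarrow> nat \<Rightarrow> (nat \<Rightarrow> nat \<Rightarrow> nat) \<Rightarrow>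
    (indet, 'k::comm_ring_1) mpoly \<Rightarrow> (indet, 'k) mpoly set" where
  "proj_B s n r d c = ideal_f s n r d +>\<^bsub>ring_C s n r d\<^esub> c"

definition B_part :: "nat \<Rightarrow> (nat \<Rightarrow> nat) \<Rightarrow> nat \<Rightarrow> (nat \<Rightarrow> nat \<Rightarrow> nat) \<Rightarrow> (nat \<Rightarrow> nat) \<Rightarrow>
    (indet, 'k::comm_ring_1) mpoly set set" where
  "B_part s n r d \<nu> = proj_B s n r d ` C_part s n r d \<nu>"

definition sigma_index :: "nat \<Rightarrow> (nat \<Rightarrow> nat) \<Rightarrow> (nat \<Rightarrow> nat) set" where
  "sigma_index s n = (\<Pi>\<^sub>E j\<in>{1..s}. {1..n j + 1})"

definition sigma :: "nat \<Rightarrow> (nat \<Rightarrow> nat) \<Rightarrow> (indet, 'k::comm_ring_1) mpoly" where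
  "sigma s \<iota> = (\<Prod>j=1..s. Var (X j (\<iota> j)))"

definition last_index :: "nat \<Rightarrow> (nat \<Rightarrow> nat) \<Rightarrow> nat \<Rightarrow> nat" where
  "last_index s n = (\<lambda>j\<in>{1..s}. n j + 1)"

definition sigma_powers :: "nat \<Rightarrow> (nat \<Rightarrow> nat) \<Rightarrow> nat \<Rightarrow> (nat \<Rightarrow> nat \<Rightarrow> nat) \<Rightarrow> (nat \<Rightarrow> nat) \<Rightarrow>
    (indet, 'k::comm_ring_1) mpoly set set" where
  "sigma_powers s n r d \<iota> = powers (ring_B s n r d) (proj_B s n r d (sigma s \<iota>))"

definition B_loc :: "nat \<Rightarrow> (nat \<Rightarrow> nat) \<Rightarrow> nat \<Rightarrow> (nat \<Rightarrow> nat \<Rightarrow> nat) \<Rightarrow> (nat \<Rightarrow> nat) \<Rightarrow>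
    ((indet, 'k::comm_ring_1) mpoly set \<times> (indet, 'k) mpoly set) set ring" where
  "B_loc s n r d \<iota> = localization (ring_B s n r d) (sigma_powers s n r d \<iota>)"

definition to_B_loc :: "nat \<Rightarrow> (nat \<Rightarrow> nat) \<Rightarrow> nat \<Rightarrow> (nat \<Rightarrow> nat \<Rightarrow> nat) \<Rightarrow> (nat \<Rightarrow> nat) \<Rightarrow>
    (indet, 'k::comm_ring_1) mpoly set \<Rightarrow> ((indet, 'k) mpoly set \<times> (indet, 'k) mpoly set) set" where
  "to_B_loc s n r d \<iota> b =
     fraction (ring_B s n r d) (sigma_powers s n r d \<iota>) b \<one>\<^bsub>ring_B s n r d\<^esub>"

text \<open>The \<open>\<int>\<^sup>s\<close>-grading of the localization at a \<open>\<sigma>\<close>: since \<open>\<sigma>\<close> has degree \<open>(1, \<dots>, 1)\<close>, the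
  fraction \<open>b / \<sigma>\<^sup>k\<close> with \<open>b\<close> homogeneous of degree \<open>\<nu>\<close> has degree \<open>(\<nu>\<^sub>1 - k, \<dots>, \<nu>\<^sub>s - k)\<close>.\<close>

definition B_loc_part :: "nat \<Rightarrow> (nat \<Rightarrow> nat) \<Rightarrow> nat \<Rightarrow> (nat \<Rightarrow> nat \<Rightarrow> nat) \<Rightarrow> (nat \<Rightarrow> nat) \<Rightarrow>
    (nat \<Rightarrow> int) \<Rightarrow> ((indet, 'k::comm_ring_1) mpoly set \<times> (indet, 'k) mpoly set) set set" where
  "B_loc_part s n r d \<iota> \<mu> =
     {fraction (ring_B s n r d) (sigma_powers s n r d \<iota>) b
        (proj_B s n r d (sigma s \<iota>) [^]\<^bsub>ring_B s n r d\<^esub> k) | b k \<nu>.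
        b \<in> B_part s n r d \<nu> \<and> (\<forall>j\<in>{1..s}. int (\<nu> j) - int k = \<mu> j)}"

definition B_loc_zero_part :: "nat \<Rightarrow> (nat \<Rightarrow> nat) \<Rightarrow> nat \<Rightarrow> (nat \<Rightarrow> nat \<Rightarrow> nat) \<Rightarrow> (nat \<Rightarrow> nat) \<Rightarrow>
    ((indet, 'k::comm_ring_1) mpoly set \<times> (indet, 'k) mpoly set) set ring" where
  "B_loc_zero_part s n r d \<iota> = (B_loc s n r d \<iota>)\<lparr>carrier := B_loc_part s n r d \<iota> (\<lambda>_. 0)\<rparr>"

definition pi_map :: "nat \<Rightarrow> (nat \<Rightarrow> nat) \<Rightarrow> nat \<Rightarrow> (nat \<Rightarrow> nat \<Rightarrow> nat) \<Rightarrow>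
    (indet, 'k::comm_ring_1) mpoly set \<Rightarrow>
    (nat \<Rightarrow> nat) \<Rightarrow> ((indet, 'k) mpoly set \<times> (indet, 'k) mpoly set) set" where
  "pi_map s n r d b = (\<lambda>\<iota>\<in>sigma_index s n. to_B_loc s n r d \<iota> b)"

definition inertia_forms :: "nat \<Rightarrow> (nat \<Rightarrow> nat) \<Rightarrow> nat \<Rightarrow> (nat \<Rightarrow> nat \<Rightarrow> nat) \<Rightarrow>
    (indet, 'k::comm_ring_1) mpoly set" where
  "inertia_forms s n r d =
     {c \<in> carrier (ring_C s n r d). proj_B s n r d c \<in>
        a_kernel (ring_B s n r d) (product_ring (sigma_index s n) (B_loc s n r d))
          (pi_map s n r d)}"

text \<open>The fraction \<open>f / (X\<^bsub>1,n\<^sub>1+1\<^esub>\<^bsup>\<nu>\<^sub>1\<^esup> \<dots> X\<^bsub>s,n\<^sub>s+1\<^esub>\<^bsup>\<nu>\<^sub>s\<^esup>)\<close> in the localization at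
  \<open>\<sigma>\<^sub>q\<close>. The denominator divides a power of \<open>\<sigma>\<^sub>q\<close> but need not be one, so the fraction
  is formed with the inverse in the localization.\<close>

definition last_monom :: "nat \<Rightarrow> (nat \<Rightarrow> nat) \<Rightarrow> (nat \<Rightarrow> nat) \<Rightarrow> (indet, 'k::comm_ring_1) mpoly" where
  "last_monom s n \<nu> = (\<Prod>j=1..s. Var (X j (n j + 1)) ^ \<nu> j)"

definition dehom_fraction :: "nat \<Rightarrow> (nat \<Rightarrow> nat) \<Rightarrow> nat \<Rightarrow> (nat \<Rightarrow> nat \<Rightarrow> nat) \<Rightarrow> (nat \<Rightarrow> nat) \<Rightarrow>
    (indet, 'k::comm_ring_1) mpoly \<Rightarrow> ((indet, 'k) mpoly set \<times> (indet, 'k) mpoly set) set" where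
  "dehom_fraction s n r d \<nu> f =
     to_B_loc s n r d (last_index s n) (proj_B s n r d f)
       \<otimes>\<^bsub>B_loc s n r d (last_index s n)\<^esub>
     inv\<^bsub>B_loc s n r d (last_index s n)\<^esub>
       to_B_loc s n r d (last_index s n) (proj_B s n r d (last_monom s n \<nu>))"

definition eps_exp :: "nat \<Rightarrow> (nat \<Rightarrow> nat) \<Rightarrow> (nat \<Rightarrow> nat \<Rightarrow> nat) \<Rightarrow> nat \<Rightarrow> nat \<Rightarrow> nat \<Rightarrow> nat" where
  "eps_exp s n d i = (\<lambda>j l. if j \<in> {1..s} \<and> l = n j + 1 then d i j else 0)"

definition eps :: "nat \<Rightarrow> (nat \<Rightarrow> nat) \<Rightarrow> (nat \<Rightarrow> nat \<Rightarrow> nat) \<Rightarrow> nat \<Rightarrow> indet" where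
  "eps s n d i = U i (eps_exp s n d i)"

definition h_poly :: "nat \<Rightarrow> (nat \<Rightarrow> nat) \<Rightarrow> (nat \<Rightarrow> nat \<Rightarrow> nat) \<Rightarrow> nat \<Rightarrow>
    (indet, 'k::comm_ring_1) mpoly" where
  "h_poly s n d i = gen_poly s n d i - Var (eps s n d i) * last_monom s n (d i)"

definition tilde_indet :: "(nat \<Rightarrow> nat) \<Rightarrow> indet \<Rightarrow> (indet, 'k::comm_ring_1) mpoly" where
  "tilde_indet n v = (case v of U i \<alpha> \<Rightarrow> Var (U i \<alpha>)
                              | X j l \<Rightarrow> if l = n j + 1 then 1 else Var (X j l))"

definition tilde :: "(nat \<Rightarrow> nat) \<Rightarrow> (indet, 'k::comm_ring_1) mpoly \<Rightarrow> (indet, 'k) mpoly" where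
  "tilde n g = subst (tilde_indet n) g"

text \<open>\<open>f(- tilde h\<^sub>1, \<dots>, - tilde h\<^sub>r, tilde X\<^sub>1, \<dots>, tilde X\<^sub>s)\<close>: each \<open>\<epsilon>\<^sub>i\<close> is
  replaced, the other \<open>U\<close> are kept.\<close>

definition elim_indet :: "nat \<Rightarrow> (nat \<Rightarrow> nat) \<Rightarrow> nat \<Rightarrow> (nat \<Rightarrow> nat \<Rightarrow> nat) \<Rightarrow> indet \<Rightarrow>
    (indet, 'k::comm_ring_1) mpoly" where
  "elim_indet s n r d v =
     (case v of U i \<alpha> \<Rightarrow> if i \<in> {1..r} \<and> v = eps s n d i then - tilde n (h_poly s n d i) else Var v
              | X j l \<Rightarrow> tilde_indet n v)"

definition elim_eps :: "nat \<Rightarrow> (nat \<Rightarrow> nat) \<Rightarrow> nat \<Rightarrow> (nat \<Rightarrow> nat \<Rightarrow> nat) \<Rightarrow>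
    (indet, 'k::comm_ring_1) mpoly \<Rightarrow> (indet, 'k) mpoly" where
  "elim_eps s n r d f = subst (elim_indet s n r d) f"


section \<open>Well-definedness\<close>

lemma finite_multi_exps: "finite (multi_exps s n d i)"
proof -
  define P where "P = (SIGMA j:{1..s}. {1..n j + 1})"
  define D where "D = (\<Sum>j=1..s. d i j)"
  have "inj_on (\<lambda>\<alpha>. restrict (case_prod \<alpha>) P) (multi_exps s n d i)"
  proof (rule inj_onI, intro ext)
    fix \<alpha> \<beta> j l
    assume ab: "\<alpha> \<in> multi_exps s n d i" "\<beta> \<in> multi_exps s n d i"
      and eq: "restrict (case_prod \<alpha>) P = restrict (case_prod \<beta>) P"
    show "\<alpha> j l = \<beta> j l"
    proof (cases "(j, l) \<in> P")
      case True
      then show ?thesis using fun_cong[OF eq, of "(j, l)"] by simp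
    next
      case False
      then have "\<alpha> j l = 0" "\<beta> j l = 0" using ab by (auto simp: P_def multi_exps_def)
      then show ?thesis by simp
    qed
  qed
  moreover have "(\<lambda>\<alpha>. restrict (case_prod \<alpha>) P) ` multi_exps s n d i \<subseteq> (\<Pi>\<^sub>E p\<in>P. {..D})"
  proof clarify
    fix \<alpha> assume a: "\<alpha> \<in> multi_exps s n d i"
    have "\<alpha> j l \<le> D" if "j \<in> {1..s}" "l \<in> {1..n j + 1}" for j l
    proof -
      have "\<alpha> j l \<le> (\<Sum>l=1..n j + 1. \<alpha> j l)" using that by (intro member_le_sum) auto
      also have "\<dots> = d i j" using a that by (simp add: multi_exps_def)
      also have "\<dots> \<le> D" unfolding D_def using that by (intro member_le_sum) auto
      finally show ?thesis .
    qed
    then show "restrict (case_prod \<alpha>) P \<in> (\<Pi>\<^sub>E p\<in>P. {..D})"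
      unfolding P_def by auto
  qed
  moreover have "finite (\<Pi>\<^sub>E p\<in>P. {..D})"
    by (intro finite_PiE) (auto simp: P_def)
  ultimately show ?thesis using finite_imageD finite_subset by blast
qed

lemma eps_exp_mem: "eps_exp s n d i \<in> multi_exps s n d i"
  by (auto simp: multi_exps_def eps_exp_def if_distrib sum.delta cong: if_cong)

lemma C_part_carrier: "f \<in> C_part s n r d \<nu> \<Longrightarrow> f \<in> carrier (ring_C s n r d)"
  by (simp add: C_part_def)

lemma ring_C_cring: "cring (ring_C s n r d)"
  by (simp add: ring_C_def mpoly_ring_cring)

lemma ring_C_simps:
  "\<one>\<^bsub>ring_C s n r d\<^esub> = 1" "\<zero>\<^bsub>ring_C s n r d\<^esub> = 0"
  "x \<otimes>\<^bsub>ring_C s n r d\<^esub> y = x * y" "x \<oplus>\<^bsub>ring_C s n r d\<^esub> y = x + y"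
  by (simp_all add: ring_C_def mpoly_ring_def)

lemma ring_C_pow: "x [^]\<^bsub>ring_C s n r d\<^esub> (k::nat) = x ^ k"
  by (induction k) (simp_all add: nat_pow_def ring_C_simps mult.commute)

lemma C_part_mult:
  assumes "f \<in> C_part s n r d \<nu>" "g \<in> C_part s n r d \<mu>"
  shows "f * g \<in> C_part s n r d (\<lambda>j. \<nu> j + \<mu> j)"
proof -
  interpret cring "ring_C s n r d" by (rule ring_C_cring)
  have "f * g \<in> carrier (ring_C s n r d)"
    using m_closed[OF assms[THEN C_part_carrier]] by (simp add: ring_C_simps)
  moreover have "(\<Sum>l=1..n j + 1. Poly_Mapping.lookup m (X j l)) = \<nu> j + \<mu> j"
    if m: "m \<in> Poly_Mapping.keys (f * g)" and j: "j \<in> {1..s}" for m j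
  proof -
    obtain a b where ab: "m = a + b" "a \<in> Poly_Mapping.keys f" "b \<in> Poly_Mapping.keys g"
      using subsetD[OF keys_mult m] by blast
    have "(\<Sum>l=1..n j + 1. Poly_Mapping.lookup a (X j l)) = \<nu> j"
      "(\<Sum>l=1..n j + 1. Poly_Mapping.lookup b (X j l)) = \<mu> j"
      using assms ab j by (auto simp: C_part_def)
    then show ?thesis unfolding ab(1) lookup_add sum.distrib by (simp only:)
  qed
  ultimately show ?thesis by (simp add: C_part_def)
qed

lemma C_part_one: "1 \<in> C_part s n r d (\<lambda>_. 0)"
  by (simp add: C_part_def ring_C_def mpoly_ring_def flip: single_one)

lemma C_part_power: "f \<in> C_part s n r d \<nu> \<Longrightarrow> f ^ k \<in> C_part s n r d (\<lambda>j. k * \<nu> j)"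
  by (induction k) (use C_part_one C_part_mult in force)+

lemma C_part_prod:
  assumes "\<And>i. i \<in> I \<Longrightarrow> F i \<in> C_part s n r d (\<nu> i)"
  shows "(\<Prod>i\<in>I. F i) \<in> C_part s n r d (\<lambda>j. \<Sum>i\<in>I. \<nu> i j)"
  using assms by (induction I rule: infinite_finite_induct) (auto intro!: C_part_one C_part_mult)

lemma Var_X_C_part:
  assumes "j \<in> {1..s}" "l \<in> {1..n j + 1}"
  shows "Var (X j l) \<in> C_part s n r d (\<lambda>k. if k = j then 1 else 0)"
  using assms
  by (auto simp: C_part_def Var_def ring_C_def mpoly_ring_def X_indets_def lookup_single when_def)

lemma last_monom_C_part: "last_monom s n \<nu> \<in> C_part s n r d \<nu>"
proof -
  have "last_monom s n \<nu> \<in> C_part s n r d (\<lambda>k. \<Sum>j=1..s. \<nu> j * (if k = j then 1 else 0))"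
    unfolding last_monom_def by (intro C_part_prod C_part_power Var_X_C_part) auto
  then show ?thesis
    by (simp add: C_part_def if_distrib[of "\<lambda>x. _ * x"] sum.delta' cong: if_cong)
qed

lemma sigma_last_index: "sigma s (last_index s n) = last_monom s n (\<lambda>_. 1)"
  by (auto simp: sigma_def last_monom_def last_index_def intro!: prod.cong)

lemma gen_poly_carrier:
  assumes "i \<in> {1..r}"
  shows "gen_poly s n d i \<in> carrier (ring_C s n r d :: (indet, 'k::comm_ring_1) mpoly ring)"
proof -
  have sum: "(\<Sum>a\<in>M. F a) \<in> carrier (ring_C s n r d)"
    if "\<And>a. a \<in> M \<Longrightarrow> F a \<in> carrier (ring_C s n r d)" for M and F :: "_ \<Rightarrow> (indet, 'k) mpoly"
    using that
  proof (induction M rule: infinite_finite_induct)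
    case (insert a M)
    interpret cring "ring_C s n r d :: (indet, 'k) mpoly ring" by (rule ring_C_cring)
    show ?case using insert a_closed[of "F a" "sum F M"] by (simp add: ring_C_simps)
  qed (simp_all add: ring_C_def mpoly_ring_def)
  show ?thesis unfolding gen_poly_def
  proof (rule sum)
    fix \<alpha> assume a: "\<alpha> \<in> multi_exps s n d i"
    have "(Var (U i \<alpha>) :: (indet, 'k) mpoly) \<in> C_part s n r d (\<lambda>_. 0)"
      using assms a
      by (auto simp: C_part_def Var_def ring_C_def mpoly_ring_def U_indets_def lookup_single when_def)
    moreover have "(\<Prod>j=1..s. \<Prod>l=1..n j + 1. Var (X j l) ^ \<alpha> j l :: (indet, 'k) mpoly) \<in>
        C_part s n r d (\<lambda>k. \<Sum>j=1..s. \<Sum>l=1..n j + 1. \<alpha> j l * (if k = j then 1 else 0))"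
      by (intro C_part_prod C_part_power Var_X_C_part)
    ultimately show "(Var (U i \<alpha>) :: (indet, 'k) mpoly) * (\<Prod>j=1..s. \<Prod>l=1..n j + 1. Var (X j l) ^ \<alpha> j l) \<in>
        carrier (ring_C s n r d)"
      by (rule C_part_carrier[OF C_part_mult])
  qed
qed

lemma ideal_f_ideal: "ideal (ideal_f s n r d) (ring_C s n r d)"
proof -
  interpret cring "ring_C s n r d" by (rule ring_C_cring)
  show ?thesis unfolding ideal_f_def
    by (intro genideal_ideal) (auto intro: gen_poly_carrier)
qed

lemma ring_B_cring: "cring (ring_B s n r d)"
  unfolding ring_B_def by (rule ideal.quotient_is_cring[OF ideal_f_ideal ring_C_cring])

lemma proj_B_hom: "proj_B s n r d \<in> ring_hom (ring_C s n r d) (ring_B s n r d)"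
  using ideal.rcos_ring_hom[OF ideal_f_ideal] by (simp add: proj_B_def[abs_def] ring_B_def)

lemma B_loc_cring:
  assumes "sigma s \<iota> \<in> carrier (ring_C s n r d :: (indet, 'k::comm_ring_1) mpoly ring)"
  shows "cring (B_loc s n r d \<iota> :: ((indet, 'k) mpoly set \<times> (indet, 'k) mpoly set) set ring)"
proof -
  interpret cring "ring_B s n r d :: (indet, 'k) mpoly set ring" by (rule ring_B_cring)
  show ?thesis unfolding B_loc_def sigma_powers_def
    by (intro localization_cring powers_submonoid ring_hom_closed[OF proj_B_hom] assms)
qed

text \<open>The fraction in the second assertion is a genuine fraction, of degree \<open>(0, \<dots>, 0)\<close>.\<close>

lemma dehom_fraction_mem:
  fixes f :: "(indet, 'k::comm_ring_1) mpoly"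
  assumes f: "f \<in> C_part s n r d \<nu>"
  defines "L \<equiv> B_loc s n r d (last_index s n) :: ((indet, 'k) mpoly set \<times> (indet, 'k) mpoly set) set ring"
  shows "to_B_loc s n r d (last_index s n) (proj_B s n r d (last_monom s n \<nu>)) \<in> Units L"
    and "dehom_fraction s n r d \<nu> f \<in> carrier (B_loc_zero_part s n r d (last_index s n))"
proof -
  define p where "p = (proj_B s n r d :: (indet, 'k) mpoly \<Rightarrow> _)"
  define \<sigma> where "\<sigma> = (sigma s (last_index s n) :: (indet, 'k) mpoly)"
  define S where "S = (sigma_powers s n r d (last_index s n) :: (indet, 'k) mpoly set set)"
  define B where "B = (ring_B s n r d :: (indet, 'k) mpoly set ring)"
  define N where "N = (\<Sum>j=1..s. \<nu> j)"
  define c where "c = (last_monom s n (\<lambda>j. N - \<nu> j) :: (indet, 'k) mpoly)"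
  define e where "e = (last_monom s n \<nu> :: (indet, 'k) mpoly)"
  interpret C: cring "ring_C s n r d :: (indet, 'k) mpoly ring" by (rule ring_C_cring)
  interpret B: cring B unfolding B_def by (rule ring_B_cring)
  interpret p: ring_hom_cring "ring_C s n r d :: (indet, 'k) mpoly ring" B p
    by unfold_locales (simp add: p_def B_def proj_B_hom)
  have \<sigma>: "\<sigma> \<in> carrier (ring_C s n r d)"
    unfolding \<sigma>_def sigma_last_index by (rule C_part_carrier[OF last_monom_C_part])
  have S_eq: "S = powers B (p \<sigma>)" by (simp add: S_def sigma_powers_def B_def p_def \<sigma>_def)
  have S: "submonoid S B" unfolding S_eq by (rule B.powers_submonoid) (simp add: \<sigma>)
  have L: "L = localization B S" by (simp add: L_def B_loc_def B_def S_def)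
  interpret L: cring L unfolding L by (rule B.localization_cring[OF S])
  note mult = B.localization_mult[OF S, folded L]
  have oneS: "\<one>\<^bsub>B\<^esub> \<in> S" by (rule submonoid.one_closed[OF S])
  have powS: "p \<sigma> [^]\<^bsub>B\<^esub> N \<in> S" unfolding S_eq powers_def by blast
  have ec: "e * c = \<sigma> ^ N"
  proof -
    have le: "\<nu> j \<le> N" if "j \<in> {1..s}" for j
      unfolding N_def using that by (intro member_le_sum) auto
    have "e * c = (\<Prod>j=1..s. Var (X j (n j + 1)) ^ (\<nu> j + (N - \<nu> j)))"
      by (simp add: e_def c_def last_monom_def power_add prod.distrib)
    also have "\<dots> = (\<Prod>j=1..s. Var (X j (n j + 1)) ^ N)"
      using le by (intro prod.cong) auto
    also have "\<dots> = \<sigma> ^ N"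
      by (simp add: \<sigma>_def sigma_last_index last_monom_def prod_power_distrib)
    finally show ?thesis .
  qed
  have carr: "e \<in> carrier (ring_C s n r d)" "c \<in> carrier (ring_C s n r d)" "f \<in> carrier (ring_C s n r d)"
    unfolding e_def c_def using f by (blast intro: C_part_carrier last_monom_C_part)+
  have p_pow: "p (\<sigma> ^ k) = p \<sigma> [^]\<^bsub>B\<^esub> k" for k :: nat
  proof (induction k)
    case 0
    then show ?case using p.hom_one by (simp add: ring_C_simps)
  next
    case (Suc k)
    have "\<sigma> ^ k \<in> carrier (ring_C s n r d)"
      using C.nat_pow_closed[OF \<sigma>, of k] by (simp add: ring_C_pow)
    then have "p (\<sigma> ^ k * \<sigma>) = p (\<sigma> ^ k) \<otimes>\<^bsub>B\<^esub> p \<sigma>"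
      using p.hom_mult[OF _ \<sigma>] by (simp add: ring_C_simps)
    then show ?case using Suc by (simp add: mult.commute)
  qed
  have p_mult: "p x \<otimes>\<^bsub>B\<^esub> p y = p (x * y)"
    if "x \<in> carrier (ring_C s n r d)" "y \<in> carrier (ring_C s n r d)" for x y
    using p.hom_mult[OF that] by (simp add: ring_C_simps)
  define y where "y = fraction B S (p e) \<one>\<^bsub>B\<^esub>"
  define z where "z = fraction B S (p c) (p \<sigma> [^]\<^bsub>B\<^esub> N)"
  have y: "y \<in> carrier L" and z: "z \<in> carrier L"
    unfolding L localization_def y_def z_def using carr oneS powS by auto
  have pow_carr: "p \<sigma> [^]\<^bsub>B\<^esub> N \<in> carrier B" using \<sigma> by simp
  have yz: "y \<otimes>\<^bsub>L\<^esub> z = \<one>\<^bsub>L\<^esub>"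
  proof -
    have "y \<otimes>\<^bsub>L\<^esub> z = fraction B S (p \<sigma> [^]\<^bsub>B\<^esub> N) (p \<sigma> [^]\<^bsub>B\<^esub> N)"
      unfolding y_def z_def using carr oneS powS pow_carr by (simp add: mult p_mult ec p_pow)
    also have "\<dots> = fraction B S \<one>\<^bsub>B\<^esub> \<one>\<^bsub>B\<^esub>"
      using oneS powS pow_carr by (intro B.fraction_eqI[OF S]) auto
    finally show ?thesis by (simp add: L localization_def)
  qed
  have to: "to_B_loc s n r d (last_index s n) (p g) = fraction B S (p g) \<one>\<^bsub>B\<^esub>" for g
    by (simp add: to_B_loc_def B_def S_def)
  show "to_B_loc s n r d (last_index s n) (proj_B s n r d (last_monom s n \<nu>)) \<in> Units L"
    using y z yz L.m_comm[OF y z] by (auto simp: Units_def to y_def e_def simp flip: p_def)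
  have inv: "inv\<^bsub>L\<^esub> y = z"
    using L.comm_inv_char[OF y z yz] by simp
  have "dehom_fraction s n r d \<nu> f = fraction B S (p f) \<one>\<^bsub>B\<^esub> \<otimes>\<^bsub>L\<^esub> z"
    unfolding dehom_fraction_def L_def[symmetric] p_def[symmetric] to inv[symmetric] y_def e_def ..
  also have "\<dots> = fraction B S (p (f * c)) (p \<sigma> [^]\<^bsub>B\<^esub> N)"
    unfolding z_def using carr oneS powS pow_carr by (simp add: mult p_mult)
  also have "\<dots> \<in> B_loc_part s n r d (last_index s n) (\<lambda>_. 0)"
  proof -
    have "f * c \<in> C_part s n r d (\<lambda>j. \<nu> j + (N - \<nu> j))"
      unfolding c_def by (intro C_part_mult f last_monom_C_part)
    moreover have "\<nu> j + (N - \<nu> j) = N" if "j \<in> {1..s}" for j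
      unfolding N_def using that member_le_sum[of j "{1..s}" \<nu>] by simp
    ultimately have "f * c \<in> C_part s n r d (\<lambda>_. N)" by (simp add: C_part_def)
    then have "p (f * c) \<in> B_part s n r d (\<lambda>_. N)" by (simp add: B_part_def p_def)
    then show ?thesis
      unfolding B_loc_part_def p_def \<sigma>_def B_def S_def by fastforce
  qed
  finally show "dehom_fraction s n r d \<nu> f \<in> carrier (B_loc_zero_part s n r d (last_index s n))"
    by (simp add: B_loc_zero_part_def)
qed

end

theory Submission
  imports Defs
begin

text \<open>Write \<open>I\<close> for the ideal of \<open>C\<close> generated by the \<open>f\<^sub>i\<close>. An element of \<open>C\<close> dies in
  \<open>B\<^bsub>\<sigma>\<^sub>\<iota>\<^esub>\<close> iff some power of \<open>\<sigma>\<^sub>\<iota>\<close> multiplies it into \<open>I\<close>. The inertia forms are therefore the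
  intersection of the saturations of \<open>I\<close> by all the \<open>\<sigma>\<^sub>\<iota>\<close>. As the denominator in the second
  assertion is a unit of \<open>B\<^bsub>\<sigma>\<^sub>q\<^esub>\<close>, that assertion says that \<open>f\<close> lies in the saturation by
  \<open>\<sigma>\<^sub>q\<close> alone (\<open>inertia_forms_iff\<close>, \<open>dehom_fraction_eq_zero_iff\<close>).

  The link with the third assertion is an elimination, available for every choice \<open>\<iota>\<close> of one pivot
  variable \<open>X j (\<iota> j)\<close> in each packet: once the pivots are invertible, \<open>f\<^sub>i = 0\<close> can be solved for
  the coefficient of its monomial in the pivots only, because \<open>f\<^sub>i\<close> is linear in that coefficient.
  The elimination sets the pivots to \<open>1\<close> and these coefficients to their solutions. It is a ring
  homomorphism that kills every \<open>f\<^sub>i\<close> and maps \<open>\<sigma>\<^sub>\<iota>\<close> to \<open>1\<close>, so it vanishes on the saturation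
  by \<open>\<sigma>\<^sub>\<iota>\<close>. Conversely, modulo \<open>I\<close> and up to a monomial in the pivots, a form \<open>f\<close> is congruent to
  a form \<open>P\<close> whose dehomogenization is the eliminated \<open>f\<close> (\<open>elim_lifts_C_part\<close>). If the latter
  vanishes, so does \<open>P\<close>, since dehomogenization is injective on forms of a given degree
  (\<open>dehom_eq_zero\<close>); hence a monomial in the pivots, and a fortiori a power of \<open>\<sigma>\<^sub>\<iota>\<close>, multiplies
  \<open>f\<close> into \<open>I\<close>. So the elimination detects the saturation by \<open>\<sigma>\<^sub>\<iota>\<close>
  (\<open>subst_elim_eq_zero_iff\<close>), and \<open>\<iota> = q\<close> gives the equivalence of the last two assertions.

  Finally, a form \<open>f\<close> in the saturation by \<open>\<sigma>\<^sub>q\<close> lies in the one by any \<open>\<sigma>\<^sub>\<iota>\<close>. The elimination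
  for \<open>\<iota>\<close> kills some \<open>\<sigma>\<^sub>q\<^sup>k f\<close>, and it maps \<open>\<sigma>\<^sub>q\<close> to a monomial. A monomial is not a zero
  divisor, so the elimination kills \<open>f\<close> itself (\<open>saturation_transfer\<close>).\<close>

section \<open>Substitution is a ring homomorphism\<close>

lemma sum_singles:
  fixes p :: "'a \<Rightarrow>\<^sub>0 'b::comm_monoid_add"
  shows "(\<Sum>m\<in>Poly_Mapping.keys p. Poly_Mapping.single m (Poly_Mapping.lookup p m)) = p"
  by (rule poly_mapping_eqI)
    (auto simp: lookup_sum lookup_single when_def in_keys_iff sum.delta)

definition monom_value :: "('v \<Rightarrow> 'a::comm_ring_1) \<Rightarrow> ('v \<Rightarrow>\<^sub>0 nat) \<Rightarrow> 'a" where
  "monom_value \<phi> m = (\<Prod>v\<in>Poly_Mapping.keys m. \<phi> v ^ Poly_Mapping.lookup m v)"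

lemma monom_value_superset:
  assumes "finite V" "Poly_Mapping.keys m \<subseteq> V"
  shows "monom_value \<phi> m = (\<Prod>v\<in>V. \<phi> v ^ Poly_Mapping.lookup m v)"
  unfolding monom_value_def using assms
  by (intro prod.mono_neutral_left) (auto simp: in_keys_iff)

lemma monom_value_add: "monom_value \<phi> (m + m') = monom_value \<phi> m * monom_value \<phi> m'"
proof -
  let ?V = "Poly_Mapping.keys m \<union> Poly_Mapping.keys m'"
  have "Poly_Mapping.keys (m + m') \<subseteq> ?V" by (rule keys_add)
  then show ?thesis
    by (simp add: monom_value_superset[of ?V] lookup_add power_add prod.distrib)
qed

lemma subst_superset:
  assumes "finite M" "Poly_Mapping.keys p \<subseteq> M"
  shows "subst \<phi> p = (\<Sum>m\<in>M. Const (Poly_Mapping.lookup p m) * monom_value \<phi> m)"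
  unfolding subst_def monom_value_def using assms
  by (intro sum.mono_neutral_left) (auto simp: in_keys_iff Const_def)

lemma subst_zero [simp]: "subst \<phi> 0 = 0"
  by (simp add: subst_def)

lemma subst_add: "subst \<phi> (p + q) = subst \<phi> p + subst \<phi> q"
proof -
  let ?M = "Poly_Mapping.keys p \<union> Poly_Mapping.keys q"
  have "Poly_Mapping.keys (p + q) \<subseteq> ?M" by (rule keys_add)
  then show ?thesis
    by (simp add: subst_superset[of ?M] lookup_add Const_def single_add distrib_right sum.distrib)
qed

lemma subst_uminus: "subst \<phi> (- p) = - subst \<phi> p"
  using subst_add[of \<phi> p "- p"] by (simp add: eq_neg_iff_add_eq_0 add.commute)

lemma subst_diff: "subst \<phi> (p - q) = subst \<phi> p - subst \<phi> q"
  using subst_add[of \<phi> p "- q"] by (simp add: subst_uminus)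

lemma subst_sum: "subst \<phi> (\<Sum>i\<in>I. p i) = (\<Sum>i\<in>I. subst \<phi> (p i))"
  by (induction I rule: infinite_finite_induct) (simp_all add: subst_add)

lemma subst_single: "subst \<phi> (Poly_Mapping.single m c) = Const c * monom_value \<phi> m"
  by (simp add: subst_superset[of "{m}"])

lemma subst_mult:
  fixes p q :: "('v, 'k::comm_ring_1) mpoly"
  shows "subst \<phi> (p * q) = subst \<phi> p * subst \<phi> q"
proof -
  define t where "t = (\<lambda>p m. Poly_Mapping.single m (Poly_Mapping.lookup p m) :: ('v, 'k) mpoly)"
  have Const_mult: "Const (a * b) = Const a * Const b" for a b :: 'k
    by (simp add: Const_def mult_single)
  have monom: "subst \<phi> (t p m * t q m') = subst \<phi> (t p m) * subst \<phi> (t q m')" for m m'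
    by (simp add: t_def mult_single subst_single monom_value_add Const_mult mult_ac)
  have dec: "p = (\<Sum>m\<in>Poly_Mapping.keys p. t p m)" for p
    by (simp add: t_def sum_singles)
  have "subst \<phi> (p * q) = (\<Sum>m\<in>Poly_Mapping.keys p. \<Sum>m'\<in>Poly_Mapping.keys q. subst \<phi> (t p m * t q m'))"
    by (subst dec[of p], subst dec[of q]) (simp add: sum_product subst_sum)
  also have "\<dots> = subst \<phi> (\<Sum>m\<in>Poly_Mapping.keys p. t p m) * subst \<phi> (\<Sum>m\<in>Poly_Mapping.keys q. t q m)"
    by (simp add: sum_product subst_sum monom)
  finally show ?thesis by (simp flip: dec)
qed

lemma subst_one [simp]: "subst \<phi> 1 = 1"
  using subst_single[of \<phi> 0 1] by (simp add: Const_def monom_value_def)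

lemma subst_Const [simp]: "subst \<phi> (Const c) = Const c"
  using subst_single[of \<phi> 0 c] by (simp add: Const_def monom_value_def)

lemma subst_Var [simp]: "subst \<phi> (Var v) = \<phi> v"
  by (simp add: Var_def subst_single monom_value_def Const_def)

lemma subst_power: "subst \<phi> (p ^ k) = subst \<phi> p ^ k"
  by (induction k) (simp_all add: subst_mult)

lemma subst_prod: "subst \<phi> (\<Prod>i\<in>I. p i) = (\<Prod>i\<in>I. subst \<phi> (p i))"
  by (induction I rule: infinite_finite_induct) (simp_all add: subst_mult)

lemmas subst_hom = subst_add subst_uminus subst_diff subst_mult subst_power subst_sum subst_prod

lemma Var_power: "Var v ^ k = Poly_Mapping.single (Poly_Mapping.single v k) 1"
  by (induction k) (simp_all add: Var_def mult_single flip: single_add)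

lemma prod_single_one:
  "(\<Prod>i\<in>I. Poly_Mapping.single (a i) 1 :: ('v, 'k::comm_ring_1) mpoly) = Poly_Mapping.single (\<Sum>i\<in>I. a i) 1"
  by (induction I rule: infinite_finite_induct) (simp_all add: mult_single)

lemma single_eq_prod_Var:
  "Poly_Mapping.single m c = Const c * (\<Prod>v\<in>Poly_Mapping.keys m. Var v ^ Poly_Mapping.lookup m v)"
  by (simp add: Var_power prod_single_one sum_singles Const_def mult_single)

text \<open>Relabelling the monomials of \<open>p\<close> without collisions only moves its coefficients.\<close>

lemma relabelled_monomials_eq_zero:
  assumes inj: "inj_on g (Poly_Mapping.keys p)"
    and zero: "(\<Sum>m\<in>Poly_Mapping.keys p. Poly_Mapping.single (g m) (Poly_Mapping.lookup p m)) = 0"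
  shows "p = (0 :: 'a \<Rightarrow>\<^sub>0 'b::comm_monoid_add)"
proof (rule poly_mapping_eqI)
  fix m
  show "Poly_Mapping.lookup p m = Poly_Mapping.lookup 0 m"
  proof (cases "m \<in> Poly_Mapping.keys p")
    case True
    have "0 = (\<Sum>m'\<in>Poly_Mapping.keys p. Poly_Mapping.lookup p m' when g m' = g m)"
      using arg_cong[OF zero, of "\<lambda>q. Poly_Mapping.lookup q (g m)"]
      by (simp add: lookup_sum lookup_single)
    also have "\<dots> = (\<Sum>m'\<in>Poly_Mapping.keys p. if m' = m then Poly_Mapping.lookup p m' else 0)"
      using inj_onD[OF inj _ _ True] by (intro sum.cong) (auto simp: when_def)
    also have "\<dots> = Poly_Mapping.lookup p m" using True by simp
    finally show ?thesis by simp
  qed (simp add: in_keys_iff)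
qed

lemma Var_mult_eq_zero:
  assumes "Var v * p = 0"
  shows "p = 0"
proof (rule relabelled_monomials_eq_zero)
  let ?g = "\<lambda>m. Poly_Mapping.single v 1 + m"
  show "inj_on ?g (Poly_Mapping.keys p)" by (simp add: inj_on_def)
  have "(\<Sum>m\<in>Poly_Mapping.keys p. Poly_Mapping.single (?g m) (Poly_Mapping.lookup p m)) =
      Var v * (\<Sum>m\<in>Poly_Mapping.keys p. Poly_Mapping.single m (Poly_Mapping.lookup p m))"
    by (simp add: sum_distrib_left Var_def mult_single)
  then show "(\<Sum>m\<in>Poly_Mapping.keys p. Poly_Mapping.single (?g m) (Poly_Mapping.lookup p m)) = 0"
    by (simp add: sum_singles assms)
qed

lemma prod_mult_eq_zero:
  fixes a :: "'i \<Rightarrow> 'a::comm_ring_1"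
  assumes "\<And>i p. i \<in> I \<Longrightarrow> a i * p = 0 \<Longrightarrow> p = 0" and "(\<Prod>i\<in>I. a i) * p = 0"
  shows "p = 0"
  using assms
proof (induction I arbitrary: p rule: infinite_finite_induct)
  case (insert i I)
  have "a i * ((\<Prod>i\<in>I. a i) * p) = 0" using insert by (simp add: mult_ac)
  then have "(\<Prod>i\<in>I. a i) * p = 0" using insert.prems(1)[of i] by blast
  then show ?case using insert by blast
qed simp_all

lemma power_mult_eq_zero:
  fixes a :: "'a::comm_ring_1"
  assumes "\<And>p. a * p = 0 \<Longrightarrow> p = 0" and "a ^ k * p = 0"
  shows "p = 0"
proof (rule prod_mult_eq_zero[of "{..<k}" "\<lambda>_. a"])
  show "(\<Prod>i<k. a) * p = 0" using assms(2) by simp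
qed (rule assms(1))


section \<open>Inertia forms as a saturation\<close>

lemma ideal_f_add: "a \<in> ideal_f s n r d \<Longrightarrow> b \<in> ideal_f s n r d \<Longrightarrow> a + b \<in> ideal_f s n r d"
  using additive_subgroup.a_closed[OF ideal.axioms(1)[OF ideal_f_ideal]] by (simp add: ring_C_simps)

lemma ideal_f_mult:
  "c \<in> carrier (ring_C s n r d) \<Longrightarrow> a \<in> ideal_f s n r d \<Longrightarrow> c * a \<in> ideal_f s n r d"
  using ideal.I_l_closed[OF ideal_f_ideal] by (simp add: ring_C_simps)

lemma ideal_f_zero: "0 \<in> ideal_f s n r d"
  using additive_subgroup.zero_closed[OF ideal.axioms(1)[OF ideal_f_ideal]] by (simp add: ring_C_simps)

lemma gen_poly_ideal_f: "i \<in> {1..r} \<Longrightarrow> gen_poly s n d i \<in> ideal_f s n r d"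
proof -
  interpret cring "ring_C s n r d" by (rule ring_C_cring)
  have "gen_poly s n d ` {1..r} \<subseteq> carrier (ring_C s n r d)" using gen_poly_carrier by blast
  then show "i \<in> {1..r} \<Longrightarrow> gen_poly s n d i \<in> ideal_f s n r d"
    unfolding ideal_f_def using genideal_self by blast
qed

lemma subst_ideal_f_eq_zero:
  fixes \<phi> :: "indet \<Rightarrow> ('w, 'k::comm_ring_1) mpoly"
  assumes gen: "\<And>i. i \<in> {1..r} \<Longrightarrow> subst \<phi> (gen_poly s n d i) = 0"
    and g: "g \<in> ideal_f s n r d"
  shows "subst \<phi> g = 0"
proof -
  let ?C = "ring_C s n r d :: (indet, 'k) mpoly ring"
  let ?D = "mpoly_ring UNIV :: ('w, 'k) mpoly ring"
  interpret C: cring ?C by (rule ring_C_cring)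
  interpret D: cring ?D by (rule mpoly_ring_cring)
  have D: "carrier ?D = UNIV" "\<zero>\<^bsub>?D\<^esub> = 0" "\<one>\<^bsub>?D\<^esub> = 1" "x \<otimes>\<^bsub>?D\<^esub> y = x * y"
      "x \<oplus>\<^bsub>?D\<^esub> y = x + y" for x y
    by (simp_all add: mpoly_ring_def)
  have "subst \<phi> \<in> ring_hom ?C ?D"
    by (rule ring_hom_memI) (simp_all only: D ring_C_simps subst_add subst_mult subst_one UNIV_I)
  then have kernel_ideal: "ideal (a_kernel ?C ?D (subst \<phi>)) ?C"
    by (rule ring_hom_ring.kernel_is_ideal[OF ring_hom_ringI2[OF C.ring_axioms D.ring_axioms]])
  have kernel: "x \<in> a_kernel ?C ?D (subst \<phi>) \<longleftrightarrow> x \<in> carrier ?C \<and> subst \<phi> x = 0" for x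
    unfolding a_kernel_def' D by simp
  have "gen_poly s n d ` {1..r} \<subseteq> a_kernel ?C ?D (subst \<phi>)"
    using gen gen_poly_carrier kernel by blast
  then have "ideal_f s n r d \<subseteq> a_kernel ?C ?D (subst \<phi>)"
    unfolding ideal_f_def by (rule C.genideal_minimal[OF kernel_ideal])
  then show ?thesis using g kernel by blast
qed

lemma proj_B_eq_zero_iff:
  assumes "c \<in> carrier (ring_C s n r d)"
  shows "proj_B s n r d c = \<zero>\<^bsub>ring_B s n r d\<^esub> \<longleftrightarrow> c \<in> ideal_f s n r d"
proof -
  interpret C: cring "ring_C s n r d" by (rule ring_C_cring)
  have sub: "subgroup (ideal_f s n r d) (add_monoid (ring_C s n r d))"
    using additive_subgroup.a_subgroup[OF ideal.axioms(1)[OF ideal_f_ideal]] .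
  show ?thesis
    using C.a_coset_join1[OF _ assms sub] C.a_coset_join2[OF assms sub]
    by (auto simp: proj_B_def ring_B_def FactRing_def)
qed

text \<open>A fraction \<open>b/1\<close> vanishes iff an element of the denominator set, here a power of
  \<open>\<sigma>\<^sub>\<iota>\<close>, annihilates \<open>b\<close>.\<close>

lemma to_B_loc_eq_zero_iff:
  fixes c :: "(indet, 'k::comm_ring_1) mpoly"
  assumes sigma: "(sigma s \<iota> :: (indet, 'k) mpoly) \<in> carrier (ring_C s n r d)"
    and c: "c \<in> carrier (ring_C s n r d)"
  shows "to_B_loc s n r d \<iota> (proj_B s n r d c) = \<zero>\<^bsub>B_loc s n r d \<iota>\<^esub> \<longleftrightarrow>
      (\<exists>k. sigma s \<iota> ^ k * c \<in> ideal_f s n r d)"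
proof -
  define p where "p = (proj_B s n r d :: (indet, 'k) mpoly \<Rightarrow> _)"
  define B where "B = (ring_B s n r d :: (indet, 'k) mpoly set ring)"
  define S where "S = (sigma_powers s n r d \<iota> :: (indet, 'k) mpoly set set)"
  define \<sigma> where "\<sigma> = (sigma s \<iota> :: (indet, 'k) mpoly)"
  interpret C: cring "ring_C s n r d :: (indet, 'k) mpoly ring" by (rule ring_C_cring)
  interpret B: cring B unfolding B_def by (rule ring_B_cring)
  interpret p: ring_hom_cring "ring_C s n r d :: (indet, 'k) mpoly ring" B p
    by unfold_locales (simp add: p_def B_def proj_B_hom)
  have S_eq: "S = powers B (p \<sigma>)" by (simp add: S_def sigma_powers_def B_def p_def \<sigma>_def)
  have \<sigma>: "\<sigma> \<in> carrier (ring_C s n r d)" using sigma by (simp add: \<sigma>_def)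
  have S: "submonoid S B" unfolding S_eq by (rule B.powers_submonoid) (simp add: \<sigma>)
  have oneS: "\<one>\<^bsub>B\<^esub> \<in> S" by (rule submonoid.one_closed[OF S])
  have pow: "\<sigma> ^ k \<in> carrier (ring_C s n r d)" for k
    using C.nat_pow_closed[OF \<sigma>, of k] by (simp add: ring_C_pow)
  have p_pow: "p (\<sigma> ^ k) = p \<sigma> [^]\<^bsub>B\<^esub> k" for k
  proof (induction k)
    case 0
    then show ?case using p.hom_one by (simp add: ring_C_simps)
  next
    case (Suc k)
    then show ?case using p.hom_mult[OF pow[of k] \<sigma>] by (simp add: ring_C_simps mult.commute)
  qed
  have clear: "p \<sigma> [^]\<^bsub>B\<^esub> k \<otimes>\<^bsub>B\<^esub> p c = \<zero>\<^bsub>B\<^esub> \<longleftrightarrow> \<sigma> ^ k * c \<in> ideal_f s n r d" for k :: nat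
  proof -
    have "p \<sigma> [^]\<^bsub>B\<^esub> k \<otimes>\<^bsub>B\<^esub> p c = p (\<sigma> ^ k * c)"
      using p.hom_mult[OF pow c, of k] by (simp add: ring_C_simps p_pow)
    moreover have "\<sigma> ^ k * c \<in> carrier (ring_C s n r d)"
      using C.m_closed[OF pow c] by (simp add: ring_C_simps)
    ultimately show ?thesis by (simp add: p_def B_def proj_B_eq_zero_iff)
  qed
  have "to_B_loc s n r d \<iota> (p c) = \<zero>\<^bsub>B_loc s n r d \<iota>\<^esub> \<longleftrightarrow>
      fraction B S (p c) \<one>\<^bsub>B\<^esub> = fraction B S \<zero>\<^bsub>B\<^esub> \<one>\<^bsub>B\<^esub>"
    by (simp add: to_B_loc_def B_loc_def localization_def B_def S_def)
  also have "\<dots> \<longleftrightarrow> (\<exists>u\<in>S. u \<otimes>\<^bsub>B\<^esub> p c = \<zero>\<^bsub>B\<^esub>)"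
    using c oneS submonoid.mem_carrier[OF S] by (subst B.fraction_eq_iff[OF S]) auto
  also have "\<dots> \<longleftrightarrow> (\<exists>k. \<sigma> ^ k * c \<in> ideal_f s n r d)"
    unfolding S_eq powers_def using clear by blast
  finally show ?thesis by (simp add: p_def \<sigma>_def)
qed

lemma sigma_carrier:
  assumes "\<And>j. j \<in> {1..s} \<Longrightarrow> \<iota> j \<in> {1..n j + 1}"
  shows "sigma s \<iota> \<in> carrier (ring_C s n r d)"
  unfolding sigma_def using assms by (intro C_part_carrier[OF C_part_prod[OF Var_X_C_part]]) auto

lemma inertia_forms_iff:
  fixes c :: "(indet, 'k::comm_ring_1) mpoly"
  assumes c: "c \<in> carrier (ring_C s n r d)"
  shows "c \<in> inertia_forms s n r d \<longleftrightarrow>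
      (\<forall>\<iota>\<in>sigma_index s n. \<exists>k. sigma s \<iota> ^ k * c \<in> ideal_f s n r d)"
proof -
  have "proj_B s n r d c \<in> carrier (ring_B s n r d)"
    using ring_hom_closed[OF proj_B_hom c] .
  then have "c \<in> inertia_forms s n r d \<longleftrightarrow>
      (\<forall>\<iota>\<in>sigma_index s n. to_B_loc s n r d \<iota> (proj_B s n r d c) = \<zero>\<^bsub>B_loc s n r d \<iota>\<^esub>)"
    using c by (auto simp: inertia_forms_def a_kernel_def' pi_map_def product_ring_def fun_eq_iff)
  also have "\<dots> \<longleftrightarrow> (\<forall>\<iota>\<in>sigma_index s n. \<exists>k. sigma s \<iota> ^ k * c \<in> ideal_f s n r d)"
    by (intro ball_cong refl to_B_loc_eq_zero_iff sigma_carrier c) (auto simp: sigma_index_def)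
  finally show ?thesis .
qed

text \<open>The fraction is the image of \<open>f\<close> times a unit, so it vanishes exactly when the image does.\<close>

lemma dehom_fraction_eq_zero_iff:
  fixes f :: "(indet, 'k::comm_ring_1) mpoly"
  assumes f: "f \<in> C_part s n r d \<nu>"
  shows "dehom_fraction s n r d \<nu> f = \<zero>\<^bsub>B_loc_zero_part s n r d (last_index s n)\<^esub> \<longleftrightarrow>
      (\<exists>k. sigma s (last_index s n) ^ k * f \<in> ideal_f s n r d)"
proof -
  define L where "L = (B_loc s n r d (last_index s n) ::
      ((indet, 'k) mpoly set \<times> (indet, 'k) mpoly set) set ring)"
  define x where "x = to_B_loc s n r d (last_index s n) (proj_B s n r d f)"
  define e where "e = to_B_loc s n r d (last_index s n)
      (proj_B s n r d (last_monom s n \<nu> :: (indet, 'k) mpoly))"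
  have sigma: "(sigma s (last_index s n) :: (indet, 'k) mpoly) \<in> carrier (ring_C s n r d)"
    by (rule sigma_carrier) (simp add: last_index_def)
  interpret L: cring L unfolding L_def by (rule B_loc_cring[OF sigma])
  interpret B: cring "ring_B s n r d :: (indet, 'k) mpoly set ring" by (rule ring_B_cring)
  have e: "e \<in> Units L" unfolding e_def L_def by (rule dehom_fraction_mem(1)[OF f])
  have "submonoid (sigma_powers s n r d (last_index s n) :: (indet, 'k) mpoly set set) (ring_B s n r d)"
    unfolding sigma_powers_def by (intro B.powers_submonoid ring_hom_closed[OF proj_B_hom sigma])
  then have x: "x \<in> carrier L"
    using ring_hom_closed[OF proj_B_hom C_part_carrier[OF f]] submonoid.one_closed
    by (auto simp: x_def L_def B_loc_def localization_def to_B_loc_def)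
  have "dehom_fraction s n r d \<nu> f = \<zero>\<^bsub>B_loc_zero_part s n r d (last_index s n)\<^esub> \<longleftrightarrow>
      x \<otimes>\<^bsub>L\<^esub> inv\<^bsub>L\<^esub> e = \<zero>\<^bsub>L\<^esub>"
    by (simp add: dehom_fraction_def B_loc_zero_part_def L_def x_def e_def)
  also have "\<dots> \<longleftrightarrow> x = \<zero>\<^bsub>L\<^esub>"
  proof
    assume "x \<otimes>\<^bsub>L\<^esub> inv\<^bsub>L\<^esub> e = \<zero>\<^bsub>L\<^esub>"
    then show "x = \<zero>\<^bsub>L\<^esub>"
      using x e L.m_assoc[of x "inv\<^bsub>L\<^esub> e" e] L.Units_closed[OF e] by simp
  qed (use e in simp)
  also have "\<dots> \<longleftrightarrow> (\<exists>k. sigma s (last_index s n) ^ k * f \<in> ideal_f s n r d)"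
    unfolding x_def L_def by (rule to_B_loc_eq_zero_iff[OF sigma C_part_carrier[OF f]])
  finally show ?thesis .
qed


section \<open>The grading\<close>

lemma C_part_cong:
  "f \<in> C_part s n r d \<nu> \<Longrightarrow> (\<And>j. j \<in> {1..s} \<Longrightarrow> \<nu> j = \<mu> j) \<Longrightarrow> f \<in> C_part s n r d \<mu>"
  by (simp add: C_part_def)

lemma C_part_zero: "0 \<in> C_part s n r d \<nu>"
  by (simp add: C_part_def ring_C_def mpoly_ring_def)

lemma C_part_add:
  assumes "f \<in> C_part s n r d \<nu>" "g \<in> C_part s n r d \<nu>"
  shows "f + g \<in> C_part s n r d \<nu>"
proof -
  have "m \<in> Poly_Mapping.keys f \<or> m \<in> Poly_Mapping.keys g" if "m \<in> Poly_Mapping.keys (f + g)" for m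
    using that keys_add[of f g] by blast
  then show ?thesis
    using assms unfolding C_part_def ring_C_def mpoly_ring_def by (simp; blast)
qed

lemma C_part_uminus: "f \<in> C_part s n r d \<nu> \<Longrightarrow> - f \<in> C_part s n r d \<nu>"
proof -
  have "Poly_Mapping.keys (- f) = Poly_Mapping.keys f" by (auto simp: in_keys_iff)
  then show "f \<in> C_part s n r d \<nu> \<Longrightarrow> - f \<in> C_part s n r d \<nu>"
    by (simp add: C_part_def ring_C_def mpoly_ring_def)
qed

lemma C_part_diff:
  "f \<in> C_part s n r d \<nu> \<Longrightarrow> g \<in> C_part s n r d \<nu> \<Longrightarrow> f - g \<in> C_part s n r d \<nu>"
  using C_part_add[of f s n r d \<nu> "- g"] by (simp add: C_part_uminus)

lemma C_part_sum:
  "(\<And>i. i \<in> I \<Longrightarrow> F i \<in> C_part s n r d \<nu>) \<Longrightarrow> (\<Sum>i\<in>I. F i) \<in> C_part s n r d \<nu>"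
  by (induction I rule: infinite_finite_induct) (auto intro: C_part_zero C_part_add)

lemma Const_C_part: "Const c \<in> C_part s n r d (\<lambda>_. 0)"
  by (simp add: C_part_def ring_C_def mpoly_ring_def Const_def)

lemma Var_U_C_part:
  assumes "i \<in> {1..r}" "\<alpha> \<in> multi_exps s n d i"
  shows "Var (U i \<alpha>) \<in> C_part s n r d (\<lambda>_. 0)"
  using assms
  by (auto simp: C_part_def Var_def ring_C_def mpoly_ring_def U_indets_def lookup_single when_def)

lemma gen_poly_C_part:
  assumes "i \<in> {1..r}"
  shows "gen_poly s n d i \<in> C_part s n r d (d i)"
  unfolding gen_poly_def
proof (rule C_part_sum)
  fix \<alpha> assume \<alpha>: "\<alpha> \<in> multi_exps s n d i"
  let ?M = "\<Prod>j=1..s. \<Prod>l=1..n j + 1. Var (X j l) ^ \<alpha> j l"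
  have "?M \<in> C_part s n r d (\<lambda>k. \<Sum>j=1..s. \<Sum>l=1..n j + 1. \<alpha> j l * (if k = j then 1 else 0))"
    by (intro C_part_prod C_part_power Var_X_C_part)
  then have "?M \<in> C_part s n r d (d i)"
  proof (rule C_part_cong)
    fix k assume "k \<in> {1..s}"
    moreover have "(\<Sum>l=1..n j + 1. \<alpha> j l * (if k = j then 1 else 0)) =
        (if k = j then \<Sum>l=1..n j + 1. \<alpha> j l else 0)" for j by simp
    ultimately show "(\<Sum>j=1..s. \<Sum>l=1..n j + 1. \<alpha> j l * (if k = j then 1 else 0)) = d i k"
      using \<alpha> by (simp add: multi_exps_def del: sum.cl_ivl_Suc)
  qed
  then show "Var (U i \<alpha>) * ?M \<in> C_part s n r d (d i)"
    using C_part_mult[OF Var_U_C_part[OF assms \<alpha>]] by simp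
qed


section \<open>Elimination of the coefficients at a chosen monomial\<close>

text \<open>The third assertion singles out the last variable of each packet. By symmetry the same
  elimination can be carried out with the variable \<open>X j (\<iota> j)\<close> of packet \<open>j\<close> instead, and the
  comparison of different choices of \<open>\<iota>\<close> is what relates the single localization at
  \<open>\<sigma>\<^sub>q\<close> to all the others.\<close>

locale pivot_choice =
  fixes s :: nat and n :: "nat \<Rightarrow> nat" and r :: nat and d :: "nat \<Rightarrow> nat \<Rightarrow> nat" and \<iota> :: "nat \<Rightarrow> nat"
  assumes pivot_range: "j \<in> {1..s} \<Longrightarrow> \<iota> j \<in> {1..n j + 1}"
begin

definition pivot_monom :: "(nat \<Rightarrow> nat) \<Rightarrow> (indet, 'k::comm_ring_1) mpoly" where
  "pivot_monom \<mu> = (\<Prod>j=1..s. Var (X j (\<iota> j)) ^ \<mu> j)"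

definition pivot_exp :: "nat \<Rightarrow> nat \<Rightarrow> nat \<Rightarrow> nat" where
  "pivot_exp i = (\<lambda>j l. if j \<in> {1..s} \<and> l = \<iota> j then d i j else 0)"

definition pivot_rest :: "nat \<Rightarrow> (indet, 'k::comm_ring_1) mpoly" where
  "pivot_rest i = gen_poly s n d i - Var (U i (pivot_exp i)) * pivot_monom (d i)"

definition dehom_indet :: "indet \<Rightarrow> (indet, 'k::comm_ring_1) mpoly" where
  "dehom_indet v = (case v of U i \<alpha> \<Rightarrow> Var v | X j l \<Rightarrow> if l = \<iota> j then 1 else Var v)"

definition elim_pivot :: "indet \<Rightarrow> (indet, 'k::comm_ring_1) mpoly" where
  "elim_pivot v = (case v of
     U i \<alpha> \<Rightarrow> if i \<in> {1..r} \<and> \<alpha> = pivot_exp i then - subst dehom_indet (pivot_rest i) else Var v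
   | X j l \<Rightarrow> dehom_indet v)"

lemma sigma_eq_pivot_monom: "sigma s \<iota> = pivot_monom (\<lambda>_. 1)"
  by (simp add: sigma_def pivot_monom_def)

lemma pivot_monom_add: "pivot_monom (\<lambda>j. \<mu> j + \<mu>' j) = pivot_monom \<mu> * pivot_monom \<mu>'"
  by (simp add: pivot_monom_def power_add prod.distrib)

lemma pivot_monom_zero: "pivot_monom (\<lambda>_. 0) = 1"
  by (simp add: pivot_monom_def)

lemma pivot_monom_carrier: "pivot_monom \<mu> \<in> carrier (ring_C s n r d)"
  unfolding pivot_monom_def
  by (intro C_part_carrier[OF C_part_prod[OF C_part_power[OF Var_X_C_part]]] pivot_range)

lemma pivot_monom_C_part: "pivot_monom \<mu> \<in> C_part s n r d \<mu>"
proof -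
  have "pivot_monom \<mu> \<in> C_part s n r d (\<lambda>k. \<Sum>j=1..s. \<mu> j * (if k = j then 1 else 0))"
    unfolding pivot_monom_def by (intro C_part_prod C_part_power Var_X_C_part pivot_range)
  then show ?thesis
    by (rule C_part_cong) (simp add: if_distrib[of "\<lambda>x. _ * x"] cong: if_cong)
qed

lemma subst_dehom_pivot_monom: "subst dehom_indet (pivot_monom \<mu>) = 1"
  by (simp add: pivot_monom_def subst_prod subst_power dehom_indet_def)

lemma subst_elim_pivot_monom: "subst elim_pivot (pivot_monom \<mu>) = 1"
  by (simp add: pivot_monom_def subst_prod subst_power elim_pivot_def dehom_indet_def)

lemma pivot_exp_mem: "pivot_exp i \<in> multi_exps s n d i"
  using pivot_range
  by (auto simp: multi_exps_def pivot_exp_def simp del: sum.cl_ivl_Suc)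

lemma pivot_exp_monom:
  "(\<Prod>j=1..s. \<Prod>l=1..n j + 1. Var (X j l) ^ pivot_exp i j l) = pivot_monom (d i)"
  unfolding pivot_monom_def
proof (rule prod.cong[OF refl])
  fix j assume j: "j \<in> {1..s}"
  then have "(\<Prod>l=1..n j + 1. Var (X j l) ^ pivot_exp i j l) =
      (\<Prod>l=1..n j + 1. if l = \<iota> j then Var (X j l) ^ d i j else 1)"
    by (intro prod.cong) (auto simp: pivot_exp_def)
  also have "\<dots> = Var (X j (\<iota> j)) ^ d i j"
    using pivot_range[OF j] by (subst prod.delta) auto
  finally show "(\<Prod>l=1..n j + 1. Var (X j l) ^ pivot_exp i j l) = Var (X j (\<iota> j)) ^ d i j" .
qed

text \<open>As a sum this remainder visibly avoids the pivot coefficient of its own equation.\<close>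

lemma pivot_rest_eq:
  "pivot_rest i = (\<Sum>\<alpha>\<in>multi_exps s n d i - {pivot_exp i}.
     Var (U i \<alpha>) * (\<Prod>j=1..s. \<Prod>l=1..n j + 1. Var (X j l) ^ \<alpha> j l))"
  unfolding pivot_rest_def gen_poly_def sum.remove[OF finite_multi_exps pivot_exp_mem]
    pivot_exp_monom by (rule add_diff_cancel_left')

lemma pivot_rest_C_part:
  assumes "i \<in> {1..r}"
  shows "pivot_rest i \<in> C_part s n r d (d i)"
proof -
  have "Var (U i (pivot_exp i)) * pivot_monom (d i) \<in> C_part s n r d (\<lambda>j. 0 + d i j)"
    by (intro C_part_mult Var_U_C_part pivot_monom_C_part pivot_exp_mem assms)
  then show ?thesis
    unfolding pivot_rest_def using C_part_diff[OF gen_poly_C_part[OF assms]] by simp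
qed

text \<open>The coefficients eliminated from the other equations do not occur in the remainder
  either, since an indeterminate \<open>U\<close> carries the number of its equation.\<close>

lemma subst_elim_pivot_rest:
  "subst elim_pivot (pivot_rest i) =
     (subst dehom_indet (pivot_rest i) :: (indet, 'k::comm_ring_1) mpoly)"
proof -
  have "elim_pivot (U i \<alpha>) = (dehom_indet (U i \<alpha>) :: (indet, 'k) mpoly)" if "\<alpha> \<noteq> pivot_exp i" for \<alpha>
    using that by (simp add: elim_pivot_def dehom_indet_def)
  moreover have "elim_pivot (X j l) = (dehom_indet (X j l) :: (indet, 'k) mpoly)" for j l
    by (simp add: elim_pivot_def)
  ultimately show ?thesis
    unfolding pivot_rest_eq by (simp add: subst_hom del: prod.cl_ivl_Suc)
qed

lemma subst_elim_gen_poly: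
  assumes "i \<in> {1..r}"
  shows "subst elim_pivot (gen_poly s n d i) = (0 :: (indet, 'k::comm_ring_1) mpoly)"
proof -
  have "(gen_poly s n d i :: (indet, 'k) mpoly) =
      Var (U i (pivot_exp i)) * pivot_monom (d i) + pivot_rest i"
    by (simp add: pivot_rest_def)
  moreover have "elim_pivot (U i (pivot_exp i)) =
      (- subst dehom_indet (pivot_rest i) :: (indet, 'k) mpoly)"
    using assms by (simp add: elim_pivot_def)
  ultimately show ?thesis
    by (simp add: subst_add subst_mult subst_elim_pivot_monom subst_elim_pivot_rest)
qed

text \<open>On monomials, setting the pivots to \<open>1\<close> erases their exponents. A pivot \<open>X j (\<iota> j)\<close> is meant
  here for every \<open>j\<close>, also outside \<open>1..s\<close>, in accordance with \<open>dehom_indet\<close>.\<close>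

definition drop_pivots :: "(indet \<Rightarrow>\<^sub>0 nat) \<Rightarrow> (indet \<Rightarrow>\<^sub>0 nat)" where
  "drop_pivots m = (\<Sum>v\<in>Poly_Mapping.keys m - (\<Union>j. {X j (\<iota> j)}).
     Poly_Mapping.single v (Poly_Mapping.lookup m v))"

lemma lookup_drop_pivots:
  "Poly_Mapping.lookup (drop_pivots m) v =
     (if v \<in> (\<Union>j. {X j (\<iota> j)}) then 0 else Poly_Mapping.lookup m v)"
  unfolding drop_pivots_def
  by (auto simp: lookup_sum lookup_single when_def in_keys_iff sum.delta)

lemma monom_value_dehom: "monom_value dehom_indet m = Poly_Mapping.single (drop_pivots m) 1"
proof -
  have "monom_value dehom_indet m =
      (\<Prod>v\<in>Poly_Mapping.keys m - (\<Union>j. {X j (\<iota> j)}). dehom_indet v ^ Poly_Mapping.lookup m v)"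
    unfolding monom_value_def
    by (rule prod.mono_neutral_right) (auto simp: dehom_indet_def)
  also have "\<dots> = (\<Prod>v\<in>Poly_Mapping.keys m - (\<Union>j. {X j (\<iota> j)}). Var v ^ Poly_Mapping.lookup m v)"
    by (intro prod.cong refl) (auto simp: dehom_indet_def split: indet.splits)
  also have "\<dots> = Poly_Mapping.single (drop_pivots m) 1"
    by (simp add: Var_power prod_single_one drop_pivots_def)
  finally show ?thesis .
qed

text \<open>Within a fixed degree the exponent of each \<open>X j (\<iota> j)\<close> is determined by the other exponents
  of packet \<open>j\<close>, so dehomogenization loses no information.\<close>

lemma dehom_eq_zero:
  assumes P: "P \<in> C_part s n r d \<nu>" and zero: "subst dehom_indet P = 0"
  shows "P = 0"
proof (rule relabelled_monomials_eq_zero)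
  show "(\<Sum>m\<in>Poly_Mapping.keys P. Poly_Mapping.single (drop_pivots m) (Poly_Mapping.lookup P m)) = 0"
    using zero subst_superset[of "Poly_Mapping.keys P" P dehom_indet]
    by (simp add: monom_value_dehom Const_def mult_single)
  show "inj_on drop_pivots (Poly_Mapping.keys P)"
  proof (rule inj_onI, rule poly_mapping_eqI)
    fix m m' v
    assume m: "m \<in> Poly_Mapping.keys P" "m' \<in> Poly_Mapping.keys P"
      and eq: "drop_pivots m = drop_pivots m'"
    have other: "Poly_Mapping.lookup m v = Poly_Mapping.lookup m' v"
      if "v \<notin> (\<Union>j. {X j (\<iota> j)})" for v
      using arg_cong[OF eq, of "\<lambda>a. Poly_Mapping.lookup a v"] that by (simp add: lookup_drop_pivots)
    show "Poly_Mapping.lookup m v = Poly_Mapping.lookup m' v"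
    proof (cases "v \<in> (\<Union>j. {X j (\<iota> j)})")
      case True
      then obtain j where v: "v = X j (\<iota> j)" by blast
      show ?thesis
      proof (cases "j \<in> {1..s}")
        case True
        \<comment> \<open>The exponents in packet \<open>j\<close> add up to \<open>\<nu> j\<close>, which leaves no freedom for the pivot.\<close>
        have split: "(\<Sum>l=1..n j + 1. Poly_Mapping.lookup a (X j l)) =
            Poly_Mapping.lookup a v + (\<Sum>l\<in>{1..n j + 1} - {\<iota> j}. Poly_Mapping.lookup a (X j l))" for a
          unfolding v by (rule sum.remove) (use pivot_range[OF True] in auto)
        have deg: "(\<Sum>l=1..n j + 1. Poly_Mapping.lookup a (X j l)) = \<nu> j" if "a \<in> Poly_Mapping.keys P" for a
          using P that True by (simp add: C_part_def del: sum.cl_ivl_Suc)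
        have "(\<Sum>l\<in>{1..n j + 1} - {\<iota> j}. Poly_Mapping.lookup m (X j l)) =
            (\<Sum>l\<in>{1..n j + 1} - {\<iota> j}. Poly_Mapping.lookup m' (X j l))"
          by (intro sum.cong refl other) auto
        then show ?thesis using deg[OF m(1)] deg[OF m(2)] unfolding split by linarith
      next
        case False
        then have "v \<notin> U_indets s n r d \<union> X_indets s n"
          by (auto simp: v U_indets_def X_indets_def)
        then have "v \<notin> Poly_Mapping.keys m" "v \<notin> Poly_Mapping.keys m'"
          using C_part_carrier[OF P] m unfolding ring_C_def mpoly_ring_def by auto
        then show ?thesis by (simp add: in_keys_iff)
      qed
    qed (rule other)
  qed
qed

text \<open>The elimination inverts the pivots and then solves \<open>f\<^sub>i = 0\<close> for its pivot coefficient.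
  Clearing denominators, \<open>g\<close> becomes congruent to a form \<open>P\<close> whose dehomogenization is the result
  of the elimination. Keeping track of the degree makes \<open>dehom_eq_zero\<close> applicable to \<open>P\<close>.\<close>

definition elim_lifts :: "(nat \<Rightarrow> nat) \<Rightarrow> (indet, 'k::comm_ring_1) mpoly \<Rightarrow> bool" where
  "elim_lifts \<nu> g \<longleftrightarrow> g \<in> carrier (ring_C s n r d) \<and>
     (\<exists>\<mu> P. P \<in> C_part s n r d (\<lambda>j. \<nu> j + \<mu> j) \<and> pivot_monom \<mu> * g - P \<in> ideal_f s n r d \<and>
            subst dehom_indet P = subst elim_pivot g)"

lemma elim_lifts_mult:
  assumes "elim_lifts \<nu> g" "elim_lifts \<nu>' g'"
  shows "elim_lifts (\<lambda>j. \<nu> j + \<nu>' j) (g * g')"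
proof -
  interpret cring "ring_C s n r d" by (rule ring_C_cring)
  from assms obtain \<mu> P \<mu>' P' where P: "P \<in> C_part s n r d (\<lambda>j. \<nu> j + \<mu> j)"
      "pivot_monom \<mu> * g - P \<in> ideal_f s n r d" "subst dehom_indet P = subst elim_pivot g"
    and P': "P' \<in> C_part s n r d (\<lambda>j. \<nu>' j + \<mu>' j)"
      "pivot_monom \<mu>' * g' - P' \<in> ideal_f s n r d" "subst dehom_indet P' = subst elim_pivot g'"
    and g: "g \<in> carrier (ring_C s n r d)" "g' \<in> carrier (ring_C s n r d)"
    unfolding elim_lifts_def by blast
  have gg': "g * g' \<in> carrier (ring_C s n r d)" and mg: "pivot_monom \<mu> * g \<in> carrier (ring_C s n r d)"
    using m_closed[OF g] m_closed[OF pivot_monom_carrier g(1)] by (simp_all add: ring_C_simps)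
  have deg: "P * P' \<in> C_part s n r d (\<lambda>j. \<nu> j + \<nu>' j + (\<mu> j + \<mu>' j))"
    using C_part_mult[OF P(1) P'(1)] by (simp add: ac_simps)
  have "pivot_monom \<mu> * g * (pivot_monom \<mu>' * g' - P') + P' * (pivot_monom \<mu> * g - P) \<in> ideal_f s n r d"
    by (intro ideal_f_add ideal_f_mult mg P(2) P'(2) C_part_carrier[OF P'(1)])
  also have "pivot_monom \<mu> * g * (pivot_monom \<mu>' * g' - P') + P' * (pivot_monom \<mu> * g - P) =
      pivot_monom (\<lambda>j. \<mu> j + \<mu>' j) * (g * g') - P * P'"
    by (simp add: pivot_monom_add algebra_simps)
  finally show ?thesis
    unfolding elim_lifts_def using gg' deg P(3) P'(3)
    by (intro conjI exI[of _ "\<lambda>j. \<mu> j + \<mu>' j"] exI[of _ "P * P'"]) (simp_all add: subst_mult)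
qed

text \<open>The two summands may need different denominators, hence the cross multiplication.\<close>

lemma elim_lifts_add:
  assumes "elim_lifts \<nu> g" "elim_lifts \<nu> g'"
  shows "elim_lifts \<nu> (g + g')"
proof -
  interpret cring "ring_C s n r d" by (rule ring_C_cring)
  from assms obtain \<mu> P \<mu>' P' where P: "P \<in> C_part s n r d (\<lambda>j. \<nu> j + \<mu> j)"
      "pivot_monom \<mu> * g - P \<in> ideal_f s n r d" "subst dehom_indet P = subst elim_pivot g"
    and P': "P' \<in> C_part s n r d (\<lambda>j. \<nu> j + \<mu>' j)"
      "pivot_monom \<mu>' * g' - P' \<in> ideal_f s n r d" "subst dehom_indet P' = subst elim_pivot g'"
    and g: "g \<in> carrier (ring_C s n r d)" "g' \<in> carrier (ring_C s n r d)"
    unfolding elim_lifts_def by blast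
  let ?Q = "pivot_monom \<mu>' * P + pivot_monom \<mu> * P'"
  have gg': "g + g' \<in> carrier (ring_C s n r d)"
    using a_closed[OF g] by (simp add: ring_C_simps)
  have "pivot_monom \<mu>' * P \<in> C_part s n r d (\<lambda>j. \<nu> j + (\<mu> j + \<mu>' j))"
    using C_part_mult[OF pivot_monom_C_part[of \<mu>'] P(1)] by (simp add: ac_simps)
  moreover have "pivot_monom \<mu> * P' \<in> C_part s n r d (\<lambda>j. \<nu> j + (\<mu> j + \<mu>' j))"
    using C_part_mult[OF pivot_monom_C_part[of \<mu>] P'(1)] by (simp add: ac_simps)
  ultimately have deg: "?Q \<in> C_part s n r d (\<lambda>j. \<nu> j + (\<mu> j + \<mu>' j))"
    by (rule C_part_add)
  have "pivot_monom \<mu>' * (pivot_monom \<mu> * g - P) + pivot_monom \<mu> * (pivot_monom \<mu>' * g' - P') \<in> ideal_f s n r d"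
    by (intro ideal_f_add ideal_f_mult pivot_monom_carrier P(2) P'(2))
  also have "pivot_monom \<mu>' * (pivot_monom \<mu> * g - P) + pivot_monom \<mu> * (pivot_monom \<mu>' * g' - P') =
      pivot_monom (\<lambda>j. \<mu> j + \<mu>' j) * (g + g') - ?Q"
    by (simp add: pivot_monom_add algebra_simps)
  finally show ?thesis
    unfolding elim_lifts_def using gg' deg P(3) P'(3)
    by (intro conjI exI[of _ "\<lambda>j. \<mu> j + \<mu>' j"] exI[of _ ?Q])
      (simp_all add: subst_mult subst_add subst_dehom_pivot_monom)
qed

lemma elim_lifts_self:
  assumes "g \<in> C_part s n r d \<nu>" "subst dehom_indet g = subst elim_pivot g"
  shows "elim_lifts \<nu> g"
  unfolding elim_lifts_def using assms
  by (intro conjI exI[of _ "\<lambda>_. 0"] exI[of _ g])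
    (simp_all add: C_part_carrier pivot_monom_zero ideal_f_zero)

lemma elim_lifts_Const: "elim_lifts (\<lambda>_. 0) (Const c)"
  by (intro elim_lifts_self Const_C_part) simp

lemma elim_lifts_sum:
  assumes "\<And>i. i \<in> I \<Longrightarrow> elim_lifts \<nu> (F i)"
  shows "elim_lifts \<nu> (\<Sum>i\<in>I. F i)"
  using assms
  by (induction I rule: infinite_finite_induct)
    (auto intro: elim_lifts_add elim_lifts_self[OF C_part_zero])

lemma elim_lifts_one: "elim_lifts (\<lambda>_. 0) 1"
  by (intro elim_lifts_self C_part_one) simp

lemma elim_lifts_power: "elim_lifts \<nu> g \<Longrightarrow> elim_lifts (\<lambda>j. k * \<nu> j) (g ^ k)"
proof (induction k)
  case (Suc k)
  then show ?case using elim_lifts_mult[of \<nu> g "\<lambda>j. k * \<nu> j" "g ^ k"] by simp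
qed (simp add: elim_lifts_one)

lemma elim_lifts_prod:
  assumes "\<And>i. i \<in> I \<Longrightarrow> elim_lifts (\<nu> i) (F i)"
  shows "elim_lifts (\<lambda>j. \<Sum>i\<in>I. \<nu> i j) (\<Prod>i\<in>I. F i)"
  using assms
  by (induction I rule: infinite_finite_induct) (auto intro: elim_lifts_one elim_lifts_mult)

lemma elim_lifts_cong:
  assumes "elim_lifts \<nu> g" "\<And>j. j \<in> {1..s} \<Longrightarrow> \<nu> j = \<nu>' j"
  shows "elim_lifts \<nu>' g"
proof -
  have "P \<in> C_part s n r d (\<lambda>j. \<nu>' j + \<mu> j)" if "P \<in> C_part s n r d (\<lambda>j. \<nu> j + \<mu> j)"
    for P :: "(indet, 'a) mpoly" and \<mu>
    using that by (rule C_part_cong) (simp add: assms(2))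
  then show ?thesis using assms(1) unfolding elim_lifts_def by blast
qed

definition indet_degree :: "indet \<Rightarrow> nat \<Rightarrow> nat" where
  "indet_degree v j = (case v of U _ _ \<Rightarrow> 0 | X j' _ \<Rightarrow> if j = j' then 1 else 0)"

lemma Var_C_part:
  assumes "v \<in> U_indets s n r d \<union> X_indets s n"
  shows "Var v \<in> C_part s n r d (indet_degree v)"
  using assms unfolding U_indets_def X_indets_def
  by (auto simp: indet_degree_def[abs_def] intro!: Var_U_C_part Var_X_C_part)

text \<open>A pivot coefficient is the one indeterminate that needs a denominator: multiplied by its
  monomial it is congruent to minus the rest of its equation.\<close>

lemma elim_lifts_Var:
  assumes v: "v \<in> U_indets s n r d \<union> X_indets s n"
  shows "elim_lifts (indet_degree v) (Var v :: (indet, 'k::comm_ring_1) mpoly)"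
proof (cases "\<exists>i\<in>{1..r}. v = U i (pivot_exp i)")
  case True
  then obtain i where i: "i \<in> {1..r}" and v: "v = U i (pivot_exp i)" by blast
  have carrier: "(Var v :: (indet, 'k) mpoly) \<in> carrier (ring_C s n r d)"
    unfolding v by (rule C_part_carrier[OF Var_U_C_part[OF i pivot_exp_mem]])
  have deg: "(- pivot_rest i :: (indet, 'k) mpoly) \<in> C_part s n r d (\<lambda>j. indet_degree v j + d i j)"
    using C_part_uminus[OF pivot_rest_C_part[OF i]] by (simp add: v indet_degree_def)
  have "pivot_monom (d i) * Var v - (- pivot_rest i) = (gen_poly s n d i :: (indet, 'k) mpoly)"
    by (simp add: v pivot_rest_def mult.commute)
  then have "pivot_monom (d i) * Var v - (- pivot_rest i :: (indet, 'k) mpoly) \<in> ideal_f s n r d"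
    using gen_poly_ideal_f[OF i] by (simp only:)
  then show ?thesis
    unfolding elim_lifts_def using carrier deg i
    by (intro conjI exI[of _ "d i"] exI[of _ "- pivot_rest i"])
      (simp_all add: subst_uminus v elim_pivot_def)
next
  case False
  then have "dehom_indet v = elim_pivot v"
    by (auto simp: dehom_indet_def elim_pivot_def split: indet.splits)
  then show ?thesis by (intro elim_lifts_self Var_C_part v) simp
qed

lemma elim_lifts_C_part:
  fixes f :: "(indet, 'k::comm_ring_1) mpoly"
  assumes f: "f \<in> C_part s n r d \<nu>"
  shows "elim_lifts \<nu> f"
proof -
  have "elim_lifts \<nu> (Poly_Mapping.single m (Poly_Mapping.lookup f m))"
    if m: "m \<in> Poly_Mapping.keys f" for m
  proof -
    let ?\<delta> = "\<lambda>j. \<Sum>v\<in>Poly_Mapping.keys m. Poly_Mapping.lookup m v * indet_degree v j"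
    let ?M = "\<Prod>v\<in>Poly_Mapping.keys m. Var v ^ Poly_Mapping.lookup m v :: (indet, 'k) mpoly"
    have vars: "v \<in> U_indets s n r d \<union> X_indets s n" if "v \<in> Poly_Mapping.keys m" for v
      using C_part_carrier[OF f] m that unfolding ring_C_def mpoly_ring_def by auto
    have "elim_lifts (\<lambda>j. 0 + ?\<delta> j) (Const (Poly_Mapping.lookup f m) * ?M)"
      by (intro elim_lifts_mult elim_lifts_Const elim_lifts_prod elim_lifts_power elim_lifts_Var vars)
    then have lifts: "elim_lifts ?\<delta> (Poly_Mapping.single m (Poly_Mapping.lookup f m))"
      by (simp add: single_eq_prod_Var)
    \<comment> \<open>The monomial \<open>m\<close> has degree \<open>?\<delta>\<close> as a product of indeterminates and degree \<open>\<nu>\<close> as a term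
      of \<open>f\<close>, so both agree on the packets \<open>1..s\<close>.\<close>
    have "?M \<in> C_part s n r d ?\<delta>"
      by (intro C_part_prod C_part_power Var_C_part vars)
    moreover have "?M = Poly_Mapping.single m 1"
      using single_eq_prod_Var[of m "1::'k"] by (simp add: Const_def)
    ultimately have "(\<Sum>l=1..n j + 1. Poly_Mapping.lookup m (X j l)) = ?\<delta> j" if "j \<in> {1..s}" for j
      using that by (simp add: C_part_def del: sum.cl_ivl_Suc)
    moreover have "(\<Sum>l=1..n j + 1. Poly_Mapping.lookup m (X j l)) = \<nu> j" if "j \<in> {1..s}" for j
      using f m that by (simp add: C_part_def del: sum.cl_ivl_Suc)
    ultimately show ?thesis by (intro elim_lifts_cong[OF lifts]) simp
  qed
  then have "elim_lifts \<nu> (\<Sum>m\<in>Poly_Mapping.keys f. Poly_Mapping.single m (Poly_Mapping.lookup f m))"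
    by (rule elim_lifts_sum)
  then show ?thesis by (simp add: sum_singles)
qed

lemma pivot_monom_dvd_sigma_power:
  "\<exists>k \<mu>'. sigma s \<iota> ^ k = pivot_monom \<mu>' * (pivot_monom \<mu> :: (indet, 'k::comm_ring_1) mpoly)"
proof -
  define k where "k = (\<Sum>j=1..s. \<mu> j)"
  have "\<mu> j \<le> k" if "j \<in> {1..s}" for j
    unfolding k_def using that by (intro member_le_sum) auto
  then have "pivot_monom (\<lambda>j. k - \<mu> j + \<mu> j) = (pivot_monom (\<lambda>_. k) :: (indet, 'k) mpoly)"
    unfolding pivot_monom_def by (intro prod.cong) auto
  also have "\<dots> = sigma s \<iota> ^ k"
    by (simp add: pivot_monom_def sigma_def prod_power_distrib)
  finally show ?thesis by (metis pivot_monom_add)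
qed

lemma subst_elim_eq_zero_iff:
  fixes f :: "(indet, 'k::comm_ring_1) mpoly"
  assumes f: "f \<in> C_part s n r d \<nu>"
  shows "subst elim_pivot f = 0 \<longleftrightarrow> (\<exists>k. sigma s \<iota> ^ k * f \<in> ideal_f s n r d)"
proof
  assume zero: "subst elim_pivot f = 0"
  obtain \<mu> P where P: "P \<in> C_part s n r d (\<lambda>j. \<nu> j + \<mu> j)"
      "pivot_monom \<mu> * f - P \<in> ideal_f s n r d" "subst dehom_indet P = subst elim_pivot f"
    using elim_lifts_C_part[OF f] unfolding elim_lifts_def by blast
  have "P = 0" using dehom_eq_zero[OF P(1)] P(3) zero by simp
  then have mem: "pivot_monom \<mu> * f \<in> ideal_f s n r d" using P(2) by simp
  obtain k \<mu>' where "sigma s \<iota> ^ k = pivot_monom \<mu>' * (pivot_monom \<mu> :: (indet, 'k) mpoly)"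
    using pivot_monom_dvd_sigma_power by blast
  then have "sigma s \<iota> ^ k * f \<in> ideal_f s n r d"
    using ideal_f_mult[OF pivot_monom_carrier mem] by (simp add: mult.assoc)
  then show "\<exists>k. sigma s \<iota> ^ k * f \<in> ideal_f s n r d" ..
next
  assume "\<exists>k. sigma s \<iota> ^ k * f \<in> ideal_f s n r d"
  then obtain k where "sigma s \<iota> ^ k * f \<in> ideal_f s n r d" ..
  then have "subst elim_pivot (sigma s \<iota> ^ k * f) = 0"
    by (rule subst_ideal_f_eq_zero[rotated]) (rule subst_elim_gen_poly)
  then show "subst elim_pivot f = 0"
    by (simp add: subst_hom sigma_eq_pivot_monom subst_elim_pivot_monom)
qed

text \<open>Each factor of \<open>\<sigma>\<^sub>\<kappa>\<close> is sent to \<open>1\<close> if it is a pivot, and to itself otherwise.\<close>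

lemma subst_elim_sigma_regular:
  assumes "subst elim_pivot (sigma s \<kappa>) * p = 0"
  shows "p = 0"
proof (rule prod_mult_eq_zero)
  show "(\<Prod>j=1..s. elim_pivot (X j (\<kappa> j))) * p = 0"
    using assms by (simp add: sigma_def subst_prod)
  show "q = 0" if "elim_pivot (X j (\<kappa> j)) * q = 0" for j and q :: "(indet, 'a) mpoly"
    using that Var_mult_eq_zero[of "X j (\<kappa> j)" q]
    by (auto simp: elim_pivot_def dehom_indet_def split: if_splits)
qed

text \<open>The elimination with pivots \<open>\<iota>\<close> detects the saturation by \<open>\<sigma>\<^sub>\<iota>\<close>, and \<open>\<sigma>\<^sub>\<kappa>\<close> can be
  cancelled after it.\<close>

lemma saturation_transfer:
  fixes f :: "(indet, 'k::comm_ring_1) mpoly"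
  assumes f: "f \<in> C_part s n r d \<nu>" and mem: "sigma s \<kappa> ^ k * f \<in> ideal_f s n r d"
  shows "\<exists>k. sigma s \<iota> ^ k * f \<in> ideal_f s n r d"
proof -
  have "subst elim_pivot (sigma s \<kappa>) ^ k * subst elim_pivot f = 0"
    using subst_ideal_f_eq_zero[OF subst_elim_gen_poly mem] by (simp add: subst_hom)
  then have "subst elim_pivot f = 0"
    by (rule power_mult_eq_zero[rotated]) (rule subst_elim_sigma_regular)
  then show ?thesis by (simp add: subst_elim_eq_zero_iff[OF f])
qed

end

text \<open>With the last variable of each packet as pivot, the elimination is the one of the third
  assertion. The pivots are given here by \<open>\<lambda>j. n j + 1\<close> for all \<open>j\<close> instead of the restricted function
  \<open>last_index s n\<close>, because \<open>tilde_indet\<close> compares with \<open>n j + 1\<close> for every \<open>j\<close>.\<close>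

lemma elim_eps_eq_zero_iff:
  fixes f :: "(indet, 'k::comm_ring_1) mpoly"
  assumes f: "f \<in> C_part s n r d \<nu>"
  shows "elim_eps s n r d f = 0 \<longleftrightarrow> (\<exists>k. sigma s (last_index s n) ^ k * f \<in> ideal_f s n r d)"
proof -
  interpret pivot_choice s n r d "\<lambda>j. n j + 1" by unfold_locales simp
  have monom: "pivot_monom \<mu> = last_monom s n \<mu>" for \<mu>
    unfolding pivot_monom_def last_monom_def ..
  have exponent: "pivot_exp = eps_exp s n d"
    unfolding pivot_exp_def eps_exp_def ..
  have rest: "pivot_rest = h_poly s n d"
    by (intro ext) (simp only: pivot_rest_def h_poly_def monom exponent eps_def)
  have dehom: "dehom_indet = tilde_indet n"
    unfolding dehom_indet_def tilde_indet_def by (auto simp: fun_eq_iff split: indet.splits)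
  have elim: "elim_pivot = (elim_indet s n r d :: indet \<Rightarrow> (indet, 'k) mpoly)"
    unfolding elim_pivot_def elim_indet_def rest dehom exponent tilde_def eps_def
    by (auto simp: fun_eq_iff split: indet.splits)
  have sigma: "sigma s (\<lambda>j. n j + 1) = (sigma s (last_index s n) :: (indet, 'k) mpoly)"
    unfolding sigma_def last_index_def by (intro prod.cong) auto
  show ?thesis
    using subst_elim_eq_zero_iff[OF f] unfolding elim_eps_def elim sigma .
qed

theorem proposition3p2:
  fixes s r :: nat and n :: "nat \<Rightarrow> nat" and d :: "nat \<Rightarrow> nat \<Rightarrow> nat" and \<nu> :: "nat \<Rightarrow> nat"
    and f :: "(indet, 'k::idom) mpoly"
  assumes "s \<ge> 1"
    and "n 1 \<ge> 1"
    and "\<And>j. j \<in> {1..<s} \<Longrightarrow> n j \<le> n (j + 1)"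
    and "\<And>i j. i \<in> {1..r} \<Longrightarrow> j \<in> {1..s} \<Longrightarrow> d i j \<ge> 1"
    and "f \<in> C_part s n r d \<nu>"
  shows "(f \<in> inertia_forms s n r d \<longleftrightarrow>
            dehom_fraction s n r d \<nu> f \<in> carrier (B_loc_zero_part s n r d (last_index s n)) \<and>
            dehom_fraction s n r d \<nu> f = \<zero>\<^bsub>B_loc_zero_part s n r d (last_index s n)\<^esub>)
       \<and> (f \<in> inertia_forms s n r d \<longleftrightarrow> elim_eps s n r d f = \<zero>\<^bsub>ring_C s n r d\<^esub>)"
proof -
  note f = assms(5)
  have "f \<in> inertia_forms s n r d \<longleftrightarrow>
      (\<exists>k. sigma s (last_index s n) ^ k * f \<in> ideal_f s n r d)" (is "_ \<longleftrightarrow> ?sat")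
  proof
    assume "f \<in> inertia_forms s n r d"
    moreover have "last_index s n \<in> sigma_index s n"
      by (simp add: last_index_def sigma_index_def)
    ultimately show ?sat
      unfolding inertia_forms_iff[OF C_part_carrier[OF f]] by blast
  next
    assume ?sat
    then obtain k where k: "sigma s (last_index s n) ^ k * f \<in> ideal_f s n r d" ..
    show "f \<in> inertia_forms s n r d"
      unfolding inertia_forms_iff[OF C_part_carrier[OF f]]
    proof
      fix \<iota> assume "\<iota> \<in> sigma_index s n"
      then interpret pivot_choice s n r d \<iota>
        by unfold_locales (auto simp: sigma_index_def)
      show "\<exists>k. sigma s \<iota> ^ k * f \<in> ideal_f s n r d" by (rule saturation_transfer[OF f k])
    qed
  qed
  then show ?thesis
    using dehom_fraction_mem(2)[OF f] dehom_fraction_eq_zero_iff[OF f] elim_eps_eq_zero_iff[OF f]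
    by (simp add: ring_C_simps)
qed

end
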